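(* Let $\Omega\subset\mathbb{R}^n$ be an open set, $s\in(0,1)$, $q\in\mathcal{P}(\Omega)$ and $p\in\mathcal{P}(\Omega\times\Omega)$, with $1<q^-\le q^+<\infty$ and $1<p^-\le p^+<\infty$. Then for every $u\in\tilde{\mathcal{W}}^{s,q(\cdot),p(\cdot,\cdot)}(\Omega)$ there exists a unique (up to an $(s,q(\cdot),p(\cdot,\cdot))$-relatively polar set) $(s,q(\cdot),p(\cdot,\cdot))$-relatively quasicontinuous function $\tilde u:\Omega\to\mathbb{R}$ such that $\tilde u=u$ a.e. in $\Omega$.
   Context: Exponents: $\mathcal{P}(\Omega)$ is the set of measurable functions $q:\Omega\to[1,\infty)$, $\mathcal{P}(\Omega\times\Omega)$ the set of measurable functions $p:\Omega\times\Omega\to[1,\infty)$; $q^-,q^+$ and $p^-,p^+$ denote the essential infimum and supremum of $q$ on $\Omega$ and of $p$ on $\Omega\times\Omega$. Modular: for measurable $u:\Omega\to\mathbb{R}$, $$\rho^{s,\Omega}_{q(\cdot),p(\cdot,\cdot)}(u)=\int_\Omega |u(x)|^{q(x)}\,dx+\int_\Omega\int_\Omega \frac{|u(x)-u(y)|^{p(x,y)}}{|x-y|^{n+sp(x,y)}}\,dx\,dy .$$ $\mathcal{W}^{s,q(\cdot),p(\cdot,\cdot)}(\Omega)$ is the space of (a.e. classes of) measurable $u$ with $\rho^{s,\Omega}_{q(\cdot),p(\cdot,\cdot)}(u)<\infty$. Its norm is $\|u\|=\|u\|_{L^{q(\cdot)}(\Omega)}+[u]$, where $\|u\|_{L^{q(\cdot)}(\Omega)}=\inf\{\lambda>0:\int_\Omega|u(x)/\lambda|^{q(x)}dx\le1\}$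 and $[u]=\inf\{\lambda>0:\int_\Omega\int_\Omega\frac{|u(x)-u(y)|^{p(x,y)}}{\lambda^{p(x,y)}|x-y|^{n+sp(x,y)}}dx\,dy\le1\}$. $\tilde{\mathcal{W}}^{s,q(\cdot),p(\cdot,\cdot)}(\Omega)$ is the closure in $\mathcal{W}^{s,q(\cdot),p(\cdot,\cdot)}(\Omega)$ of $\mathcal{W}^{s,q(\cdot),p(\cdot,\cdot)}(\Omega)\cap\mathscr{C}_c(\overline\Omega)$, where $\mathscr{C}_c(\overline\Omega)$ is the space of continuous functions on $\overline\Omega$ with compact support in $\overline\Omega$. Relative capacity: for $O\subset\overline\Omega$ open in the relative topology of $\overline\Omega$, $$C^{s,\Omega}_{q(\cdot),p(\cdot,\cdot)}(O)=\inf\{\rho^{s,\Omega}_{q(\cdot),p(\cdot,\cdot)}(u): u\in\tilde{\mathcal{W}}^{s,q(\cdot),p(\cdot,\cdot)}(\Omega),\ u\ge1\text{ a.e. on }O\cap\Omega\},$$ and for arbitrary $E\subset\overline\Omega$, $C^{s,\Omega}_{q(\cdot),p(\cdot,\cdot)}(E)=\inf\{C^{s,\Omega}_{q(\cdot),p(\cdot,\cdot)}(O): O\text{ relatively open in }\overline\Omega,\ E\subset O\}$. A set $P\subset\Omega$ is $(s,q(\cdot),p(\cdot,\cdot))$-relatively polar if $C^{s,\Omega}_{q(\cdot),p(\cdot,\cdot)}(P)=0$. A function $w:\Omega\to\mathbb{R}$ is $(s,q(\cdot),p(\cdot,\cdot))$-relatively quasicontinuous if for every $\varepsilon>0$ there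 is a relatively open set $O_\varepsilon\subset\Omega$ with $C^{s,\Omega}_{q(\cdot),p(\cdot,\cdot)}(O_\varepsilon)<\varepsilon$ such that $w$ is continuous on $\Omega\setminus O_\varepsilon$. Uniqueness means that two such functions agree outside a relatively polar subset of $\Omega$. *)

theory Defs
  imports "HOL-Analysis.Analysis" "HOL-Probability.Essential_Supremum"
begin

text \<open>
  Functions on \<open>\<Omega>\<close> are represented by total functions of which only the values on \<open>\<Omega>\<close>
  matter (on the closure of \<open>\<Omega>\<close> for the functions in \<open>Cc_closure \<Omega>\<close> below), and classes modulo
  equality almost everywhere by their representatives.
  ``Measurable'' means Lebesgue measurable. Modulars, norms and capacities take values
  in \<open>[0, \<infinity>]\<close>, so that the infimum of the empty set is \<open>\<infinity>\<close>.
\<close>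

definition exponents :: "'a::euclidean_space set \<Rightarrow> ('a \<Rightarrow> real) set"
  where "exponents A = {q \<in> borel_measurable (lebesgue_on A). \<forall>x\<in>A. 1 \<le> q x}"

text \<open>The counterpart of the library's \<^const>\<open>esssup\<close>.\<close>

definition essinf :: "'a measure \<Rightarrow> ('a \<Rightarrow> ereal) \<Rightarrow> ereal"
  where "essinf M f = Sup {z. AE x in M. z \<le> f x}"

definition exponent_inf :: "'a::euclidean_space set \<Rightarrow> ('a \<Rightarrow> real) \<Rightarrow> ereal"
  where "exponent_inf A q = essinf (lebesgue_on A) (\<lambda>x. ereal (q x))"

definition exponent_sup :: "'a::euclidean_space set \<Rightarrow> ('a \<Rightarrow> real) \<Rightarrow> ereal"
  where "exponent_sup A q = esssup (lebesgue_on A) (\<lambda>x. ereal (q x))"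

definition Lq_modular :: "'a::euclidean_space set \<Rightarrow> ('a \<Rightarrow> real) \<Rightarrow> ('a \<Rightarrow> real) \<Rightarrow> ennreal"
  where "Lq_modular \<Omega> q u = (\<integral>\<^sup>+x. ennreal (\<bar>u x\<bar> powr q x) \<partial>lebesgue_on \<Omega>)"

text \<open>
  At \<open>x = y\<close> the integrands below are \<open>0 / 0 = 0\<close>; the diagonal is a null set.
\<close>

definition gagliardo_modular ::
    "'a::euclidean_space set \<Rightarrow> real \<Rightarrow> ('a \<times> 'a \<Rightarrow> real) \<Rightarrow> ('a \<Rightarrow> real) \<Rightarrow> ennreal"
  where "gagliardo_modular \<Omega> s p u =
    (\<integral>\<^sup>+y. \<integral>\<^sup>+x. ennreal (\<bar>u x - u y\<bar> powr p (x, y)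
        / norm (x - y) powr (real DIM('a) + s * p (x, y)))
      \<partial>lebesgue_on \<Omega> \<partial>lebesgue_on \<Omega>)"

definition frac_modular ::
    "'a::euclidean_space set \<Rightarrow> real \<Rightarrow> ('a \<Rightarrow> real) \<Rightarrow> ('a \<times> 'a \<Rightarrow> real) \<Rightarrow> ('a \<Rightarrow> real) \<Rightarrow> ennreal"
  where "frac_modular \<Omega> s q p u = Lq_modular \<Omega> q u + gagliardo_modular \<Omega> s p u"

definition frac_sobolev ::
    "'a::euclidean_space set \<Rightarrow> real \<Rightarrow> ('a \<Rightarrow> real) \<Rightarrow> ('a \<times> 'a \<Rightarrow> real) \<Rightarrow> ('a \<Rightarrow> real) set"
  where "frac_sobolev \<Omega> s q p =
    {u \<in> borel_measurable (lebesgue_on \<Omega>). frac_modular \<Omega> s q p u < \<infinity>}"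

definition Lq_norm :: "'a::euclidean_space set \<Rightarrow> ('a \<Rightarrow> real) \<Rightarrow> ('a \<Rightarrow> real) \<Rightarrow> ennreal"
  where "Lq_norm \<Omega> q u =
    (INF t\<in>{t::real. 0 < t \<and> Lq_modular \<Omega> q (\<lambda>x. u x / t) \<le> 1}. ennreal t)"

definition gagliardo_seminorm ::
    "'a::euclidean_space set \<Rightarrow> real \<Rightarrow> ('a \<times> 'a \<Rightarrow> real) \<Rightarrow> ('a \<Rightarrow> real) \<Rightarrow> ennreal"
  where "gagliardo_seminorm \<Omega> s p u =
    (INF t\<in>{t::real. 0 < t \<and>
        (\<integral>\<^sup>+y. \<integral>\<^sup>+x. ennreal (\<bar>u x - u y\<bar> powr p (x, y)
            / (t powr p (x, y) * norm (x - y) powr (real DIM('a) + s * p (x, y))))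
          \<partial>lebesgue_on \<Omega> \<partial>lebesgue_on \<Omega>) \<le> 1}. ennreal t)"

definition frac_norm ::
    "'a::euclidean_space set \<Rightarrow> real \<Rightarrow> ('a \<Rightarrow> real) \<Rightarrow> ('a \<times> 'a \<Rightarrow> real) \<Rightarrow> ('a \<Rightarrow> real) \<Rightarrow> ennreal"
  where "frac_norm \<Omega> s q p u = Lq_norm \<Omega> q u + gagliardo_seminorm \<Omega> s p u"

definition Cc_closure :: "'a::euclidean_space set \<Rightarrow> ('a \<Rightarrow> real) set"
  where "Cc_closure \<Omega> =
    {v. continuous_on (closure \<Omega>) v \<and> compact (closure {x \<in> closure \<Omega>. v x \<noteq> 0})}"

text \<open>
  The norm does not distinguish functions that agree almost everywhere on \<open>\<Omega>\<close>, so this set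
  contains all representatives of the classes in the closure.
\<close>

definition frac_sobolev_tilde ::
    "'a::euclidean_space set \<Rightarrow> real \<Rightarrow> ('a \<Rightarrow> real) \<Rightarrow> ('a \<times> 'a \<Rightarrow> real) \<Rightarrow> ('a \<Rightarrow> real) set"
  where "frac_sobolev_tilde \<Omega> s q p =
    {u \<in> frac_sobolev \<Omega> s q p. \<forall>\<epsilon>>0::real.
       \<exists>v \<in> frac_sobolev \<Omega> s q p \<inter> Cc_closure \<Omega>. frac_norm \<Omega> s q p (\<lambda>x. u x - v x) < ennreal \<epsilon>}"

definition rel_capacity_open ::
    "'a::euclidean_space set \<Rightarrow> real \<Rightarrow> ('a \<Rightarrow> real) \<Rightarrow> ('a \<times> 'a \<Rightarrow> real) \<Rightarrow> 'a set \<Rightarrow> ennreal"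
  where "rel_capacity_open \<Omega> s q p U =
    (INF u\<in>{u \<in> frac_sobolev_tilde \<Omega> s q p. AE x in lebesgue. x \<in> U \<inter> \<Omega> \<longrightarrow> 1 \<le> u x}.
       frac_modular \<Omega> s q p u)"

text \<open>
  By monotonicity, \<open>rel_capacity\<close> agrees with \<open>rel_capacity_open\<close> on relatively open sets.
\<close>

definition rel_capacity ::
    "'a::euclidean_space set \<Rightarrow> real \<Rightarrow> ('a \<Rightarrow> real) \<Rightarrow> ('a \<times> 'a \<Rightarrow> real) \<Rightarrow> 'a set \<Rightarrow> ennreal"
  where "rel_capacity \<Omega> s q p E =
    (INF U\<in>{U. openin (top_of_set (closure \<Omega>)) U \<and> E \<subseteq> U}. rel_capacity_open \<Omega> s q p U)"

definition rel_polar ::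
    "'a::euclidean_space set \<Rightarrow> real \<Rightarrow> ('a \<Rightarrow> real) \<Rightarrow> ('a \<times> 'a \<Rightarrow> real) \<Rightarrow> 'a set \<Rightarrow> bool"
  where "rel_polar \<Omega> s q p P \<longleftrightarrow> P \<subseteq> \<Omega> \<and> rel_capacity \<Omega> s q p P = 0"

text \<open>
  Continuity on \<open>\<Omega> - U\<close> is continuity of the restriction to that set.
\<close>

definition rel_quasicontinuous ::
    "'a::euclidean_space set \<Rightarrow> real \<Rightarrow> ('a \<Rightarrow> real) \<Rightarrow> ('a \<times> 'a \<Rightarrow> real) \<Rightarrow> ('a \<Rightarrow> real) \<Rightarrow> bool"
  where "rel_quasicontinuous \<Omega> s q p w \<longleftrightarrow>
    (\<forall>\<epsilon>>0::real. \<exists>U. openin (top_of_set (closure \<Omega>)) U \<and> U \<subseteq> \<Omega> \<and>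
       rel_capacity \<Omega> s q p U < ennreal \<epsilon> \<and> continuous_on (\<Omega> - U) w)"

end

theory Submission
  imports Defs
begin

text \<open>
  As the exponents are bounded by some \<open>P\<close>, the modular \<open>\<rho>\<close> is equivalent to the norm as far as
  convergence is concerned, and it is countably quasi-subadditive with geometric weights:
  \<open>\<rho> (\<Sum>k. f k) \<le> (\<Sum>k. 2\<^sup>P\<^sup>(\<^sup>k\<^sup>+\<^sup>1\<^sup>) \<rho> (f k))\<close>.  This replaces lattice operations on the space
  and the strong subadditivity of the capacity.  Approximate \<open>u\<close> rapidly by continuous \<open>v k\<close>. The
  function \<open>\<Sum>k\<ge>m. 2\<^sup>k \<bar>v (k + 1) - v k\<bar>\<close> is again in the closure of the continuous functions, has
  small modular, and is at least 1 wherever some \<open>\<bar>v (k + 1) - v k\<bar>\<close> with \<open>k \<ge> m\<close> exceeds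
  \<open>2\<^sup>-\<^sup>k\<close>; off this open set the \<open>v k\<close> converge uniformly. With \<open>m = 0\<close> and \<open>v 0 = 0\<close> the same series
  is a majorant of \<open>\<bar>u\<bar>\<close>, so that two test functions can be added without cancellation.
  For uniqueness, if \<open>w1 = w2\<close> almost everywhere and both are continuous off the open set
  \<open>U\<close>, then \<open>{w1 \<noteq> w2} \<union> U\<close> is open and differs from \<open>U\<close> by a null set, so that both sets have the
  same test functions.
\<close>

section \<open>Quasi-subadditivity of powers with bounded exponents\<close>

lemma powr_add_le:
  fixes a b r P :: real
  assumes "0 \<le> a" "0 \<le> b" "0 \<le> r" "r \<le> P"
  shows "(a + b) powr r \<le> 2 powr P * (a powr r + b powr r)"
proof -
  define c where "c = max a b"
  have "(a + b) powr r \<le> (2 * c) powr r"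
    using assms by (intro powr_mono2) (auto simp: c_def)
  also have "\<dots> = 2 powr r * c powr r"
    using assms by (simp add: powr_mult c_def)
  also have "\<dots> \<le> 2 powr P * (a powr r + b powr r)"
    using assms by (intro mult_mono powr_mono) (auto simp: c_def max_def)
  finally show ?thesis .
qed

text \<open>Splitting off the first term costs a factor \<open>2 powr P\<close> on everything behind
  it, so the term at \<open>k\<close> collects \<open>k + 1\<close> such factors. These weights do
  not depend on \<open>N\<close>, which allows the passage to infinite series.\<close>

lemma sum_powr_le:
  fixes a :: "nat \<Rightarrow> real"
  assumes "\<And>k. 0 \<le> a k" "0 \<le> r" "r \<le> P"
  shows "(\<Sum>k<N. a k) powr r \<le> (\<Sum>k<N. 2 powr (real (Suc k) * P) * a k powr r)"
  using assms(1)
proof (induction N arbitrary: a)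
  case 0
  then show ?case by simp
next
  case (Suc N)
  have "(\<Sum>k<Suc N. a k) powr r = (a 0 + (\<Sum>k<N. a (Suc k))) powr r"
    by (simp only: sum.lessThan_Suc_shift)
  also have "\<dots> \<le> 2 powr P * (a 0 powr r + (\<Sum>k<N. a (Suc k)) powr r)"
    using Suc.prems assms by (intro powr_add_le) (auto intro: sum_nonneg)
  also have "\<dots> \<le> 2 powr P * (a 0 powr r + (\<Sum>k<N. 2 powr (real (Suc k) * P) * a (Suc k) powr r))"
    using Suc.IH[of "\<lambda>k. a (Suc k)"] Suc.prems by (intro mult_left_mono add_left_mono) auto
  also have "\<dots> = (\<Sum>k<Suc N. 2 powr (real (Suc k) * P) * a k powr r)"
    by (simp add: sum.lessThan_Suc_shift distrib_left sum_distrib_left mult.assoc[symmetric]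
        powr_add[symmetric] algebra_simps del: sum.lessThan_Suc)
  finally show ?case .
qed

text \<open>Finiteness of the weighted series of powers already forces convergence of the series itself,
  since \<open>a \<le> 2\<^sup>-\<^sup>k (1 + (2\<^sup>k a)\<^sup>r)\<close>.\<close>

lemma summable_of_weighted_powr:
  fixes a :: "nat \<Rightarrow> real"
  assumes a: "\<And>k. 0 \<le> a k" and r: "1 \<le> r" "r \<le> P"
    and sm: "summable (\<lambda>k. 2 powr (real (Suc k) * P) * a k powr r)"
  shows "summable a"
proof (rule summable_comparison_test')
  show "summable (\<lambda>k. (1/2) ^ k + 2 powr (real (Suc k) * P) * a k powr r)"
    by (intro summable_add sm summable_geometric) auto
  fix k :: nat assume "0 \<le> k"
  show "norm (a k) \<le> (1/2) ^ k + 2 powr (real (Suc k) * P) * a k powr r"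
  proof (cases "a k \<le> (1/2) ^ k")
    case True
    then show ?thesis using a[of k] by (simp add: add_increasing2)
  next
    case False
    then have ak: "1 \<le> 2 ^ k * a k"
      by (simp add: field_simps power_divide)
    have apos: "0 < a k"
      using False zero_less_power[of "1/2::real" k] by linarith
    have "a k \<le> 2 ^ k * a k"
      using apos by (simp add: mult_le_cancel_right1)
    also have "\<dots> = (2 ^ k * a k) powr 1"
      using apos by simp
    also have "\<dots> \<le> (2 ^ k * a k) powr r"
      using r ak by (intro powr_mono) auto
    also have "\<dots> = 2 powr (real k * r) * a k powr r"
      using apos by (simp add: powr_mult powr_powr powr_realpow[symmetric])
    also have "\<dots> \<le> 2 powr (real (Suc k) * P) * a k powr r"
      using r by (intro mult_right_mono powr_mono mult_mono) auto
    finally show ?thesis using apos by (simp add: add_increasing)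
  qed
qed

lemma suminf_powr_le:
  fixes a :: "nat \<Rightarrow> real"
  assumes a: "\<And>k. 0 \<le> a k" and r: "1 \<le> r" "r \<le> P"
    and sm: "summable (\<lambda>k. 2 powr (real (Suc k) * P) * a k powr r)"
  shows "(\<Sum>k. a k) powr r \<le> (\<Sum>k. 2 powr (real (Suc k) * P) * a k powr r)"
proof (rule LIMSEQ_le_const2)
  have "summable a"
    using summable_of_weighted_powr[OF assms] .
  then have "(\<lambda>N. \<Sum>k<N. a k) \<longlonglongrightarrow> (\<Sum>k. a k)"
    by (rule summable_LIMSEQ)
  then show "(\<lambda>N. (\<Sum>k<N. a k) powr r) \<longlonglongrightarrow> (\<Sum>k. a k) powr r"
    using r a by (intro tendsto_powr') (auto intro!: sum_nonneg always_eventually)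
  have "(\<Sum>k<n. a k) powr r \<le> (\<Sum>k. 2 powr (real (Suc k) * P) * a k powr r)" for n
    using r sum_le_suminf[OF sm, of "{..<n}"] by (intro order_trans[OF sum_powr_le[OF a]]) auto
  then show "\<exists>N. \<forall>n\<ge>N. (\<Sum>k<n. a k) powr r \<le> (\<Sum>k. 2 powr (real (Suc k) * P) * a k powr r)"
    by blast
qed

section \<open>Weighted power modulars over a measure\<close>

text \<open>A common form for both parts of the modular: the weight \<open>K\<close> is 1 on
  \<open>\<Omega>\<close> and the singular kernel on pairs, so that every estimate is proved
  once.\<close>

definition pow_modular :: "'b measure \<Rightarrow> ('b \<Rightarrow> real) \<Rightarrow> ('b \<Rightarrow> real) \<Rightarrow> ('b \<Rightarrow> real) \<Rightarrow> ennreal"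
  where "pow_modular M r K U = (\<integral>\<^sup>+z. ennreal (\<bar>U z\<bar> powr r z * K z) \<partial>M)"

lemma pow_modular_mono:
  assumes "AE z in M. 1 \<le> r z \<and> r z \<le> P \<and> 0 \<le> K z" "AE z in M. \<bar>U z\<bar> \<le> \<bar>V z\<bar>"
  shows "pow_modular M r K U \<le> pow_modular M r K V"
  unfolding pow_modular_def
  by (rule nn_integral_mono_AE, use assms in eventually_elim)
    (auto intro!: ennreal_leI mult_right_mono powr_mono2)

text \<open>The constant \<open>c\<close> is left open because different exponents are decisive: the
  least one, 1, for small \<open>\<bar>t\<bar>\<close>, and the largest one, \<open>P\<close>, when
  \<open>\<bar>t\<bar>\<close> exceeds 1.\<close>

lemma pow_modular_cmult_le:
  assumes b: "AE z in M. 1 \<le> r z \<and> r z \<le> P \<and> 0 \<le> K z" and c: "0 \<le> c"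
    and le: "\<And>\<rho>. 1 \<le> \<rho> \<Longrightarrow> \<rho> \<le> P \<Longrightarrow> \<bar>t\<bar> powr \<rho> \<le> c"
    and [measurable]: "U \<in> borel_measurable M" "r \<in> borel_measurable M" "K \<in> borel_measurable M"
  shows "pow_modular M r K (\<lambda>z. t * U z) \<le> ennreal c * pow_modular M r K U"
proof -
  have "pow_modular M r K (\<lambda>z. t * U z) \<le> (\<integral>\<^sup>+z. ennreal c * ennreal (\<bar>U z\<bar> powr r z * K z) \<partial>M)"
    unfolding pow_modular_def
  proof (rule nn_integral_mono_AE, use b in eventually_elim)
    case (elim z)
    have "\<bar>t * U z\<bar> powr r z * K z = \<bar>t\<bar> powr r z * (\<bar>U z\<bar> powr r z * K z)"
      by (simp add: abs_mult powr_mult)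
    also have "\<dots> \<le> c * (\<bar>U z\<bar> powr r z * K z)"
      using elim le[of "r z"] by (intro mult_right_mono) auto
    finally show ?case
      using c by (simp add: ennreal_mult'[symmetric] ennreal_leI)
  qed
  also have "\<dots> = ennreal c * pow_modular M r K U"
    unfolding pow_modular_def by (rule nn_integral_cmult) measurable
  finally show ?thesis .
qed

text \<open>The pointwise inequality for powers of series is integrated term by term; all terms are
  nonnegative.\<close>

lemma pow_modular_suminf_le:
  assumes b: "AE z in M. 1 \<le> r z \<and> r z \<le> P \<and> 0 \<le> K z"
    and m[measurable]: "\<And>k. U k \<in> borel_measurable M" "r \<in> borel_measurable M" "K \<in> borel_measurable M"
    and V: "AE z in M. (\<lambda>k. U k z) sums V z"
  shows "pow_modular M r K V \<le> (\<Sum>k. ennreal (2 powr (real (Suc k) * P)) * pow_modular M r K (U k))"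
proof -
  have "pow_modular M r K V \<le> (\<integral>\<^sup>+z. (\<Sum>k. ennreal (2 powr (real (Suc k) * P)) * ennreal (\<bar>U k z\<bar> powr r z * K z)) \<partial>M)"
    unfolding pow_modular_def
  proof (rule nn_integral_mono_AE, use b V in eventually_elim)
    case (elim z)
    let ?w = "\<lambda>k. 2 powr (real (Suc k) * P) * \<bar>U k z\<bar> powr r z"
    have eq: "(\<Sum>k. ennreal (2 powr (real (Suc k) * P)) * ennreal (\<bar>U k z\<bar> powr r z * K z))
      = (\<Sum>k. ennreal (?w k)) * ennreal (K z)"
      using elim by (simp add: ennreal_suminf_multc[symmetric] ennreal_mult'[symmetric] ennreal_mult''[symmetric] mult.assoc
          del: ennreal_suminf_multc)
    show ?case
    proof (cases "summable ?w \<and> K z \<noteq> 0")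
      case True
      then have sm: "summable ?w" by simp
      \<comment> \<open>The series for \<open>V z\<close> may converge only conditionally by
        assumption. Convergence of the weighted powers makes it absolute, as the triangle inequality
        for the infinite sum requires.\<close>
      have sa: "summable (\<lambda>k. \<bar>U k z\<bar>)"
        using summable_of_weighted_powr[of "\<lambda>k. \<bar>U k z\<bar>"] elim sm by auto
      have "V z = (\<Sum>k. U k z)" using elim by (simp add: sums_iff)
      then have "\<bar>V z\<bar> \<le> (\<Sum>k. \<bar>U k z\<bar>)"
        using summable_rabs[OF sa] by simp
      then have "\<bar>V z\<bar> powr r z \<le> (\<Sum>k. \<bar>U k z\<bar>) powr r z"
        using elim by (intro powr_mono2) auto
      also have "\<dots> \<le> (\<Sum>k. ?w k)"
        using suminf_powr_le[of "\<lambda>k. \<bar>U k z\<bar>"] elim sm by auto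
      finally have "ennreal (\<bar>V z\<bar> powr r z * K z) \<le> ennreal ((\<Sum>k. ?w k) * K z)"
        using elim by (intro ennreal_leI mult_right_mono) auto
      also have "\<dots> = (\<Sum>k. ennreal (?w k)) * ennreal (K z)"
        using elim by (subst suminf_ennreal2[OF _ sm]) (auto simp: ennreal_mult'')
      finally show ?thesis unfolding eq .
    next
      case False
      \<comment> \<open>In the first case both sides are 0, in the second the right side is
        infinite.\<close>
      then consider "K z = 0" | "0 < K z" "\<not> summable ?w" using elim by fastforce
      then show ?thesis
      proof cases
        case 2
        then have "(\<Sum>k. ennreal (?w k)) = top"
          using summable_suminf_not_top[of ?w] by fastforce
        then show ?thesis unfolding eq using 2 by (simp add: ennreal_top_mult)
      qed simp
    qed
  qed
  also have "\<dots> = (\<Sum>k. ennreal (2 powr (real (Suc k) * P)) * pow_modular M r K (U k))"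
    unfolding pow_modular_def by (subst nn_integral_suminf) (auto simp: nn_integral_cmult)
  finally show ?thesis .
qed

text \<open>A finite integral has an almost everywhere finite integrand. The weight is 1 here
  because nothing could be concluded where a weight vanishes.\<close>

lemma AE_summable_of_pow_modular:
  assumes b: "AE z in M. 1 \<le> r z \<and> r z \<le> P"
    and m[measurable]: "\<And>k. U k \<in> borel_measurable M" "r \<in> borel_measurable M"
    and fin: "(\<Sum>k. ennreal (2 powr (real (Suc k) * P)) * pow_modular M r (\<lambda>_. 1) (U k)) < \<infinity>"
  shows "AE z in M. summable (\<lambda>k. \<bar>U k z\<bar>)"
proof -
  have "(\<integral>\<^sup>+z. (\<Sum>k. ennreal (2 powr (real (Suc k) * P) * \<bar>U k z\<bar> powr r z)) \<partial>M)
    = (\<Sum>k. ennreal (2 powr (real (Suc k) * P)) * pow_modular M r (\<lambda>_. 1) (U k))"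
    unfolding pow_modular_def by (subst nn_integral_suminf) (auto simp: nn_integral_cmult ennreal_mult')
  with fin have "AE z in M. (\<Sum>k. ennreal (2 powr (real (Suc k) * P) * \<bar>U k z\<bar> powr r z)) \<noteq> \<infinity>"
    by (intro nn_integral_noteq_infinite) auto
  with b show ?thesis
  proof eventually_elim
    case (elim z)
    then have "summable (\<lambda>k. 2 powr (real (Suc k) * P) * \<bar>U k z\<bar> powr r z)"
      by (intro summable_suminf_not_top) auto
    then show ?case using summable_of_weighted_powr[of "\<lambda>k. \<bar>U k z\<bar>"] elim by auto
  qed
qed

section \<open>The setting: exponents, measures and their product\<close>

text \<open>A countable cover that works for \<open>lborel\<close> also works for its completion.
  Products and Tonelli's theorem for \<open>lebesgue_on \<Omega>\<close> rest on this.\<close>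

lemma sigma_finite_lebesgue: "sigma_finite_measure (lebesgue :: 'a::euclidean_space measure)"
proof
  obtain A :: "'a set set" where A: "countable A" "A \<subseteq> sets lborel" "\<Union>A = space lborel"
    "\<forall>a\<in>A. emeasure lborel a \<noteq> \<infinity>"
    using lborel.sigma_finite_countable by metis
  have "a \<in> sets lebesgue \<and> emeasure lebesgue a \<noteq> \<infinity>" if "a \<in> A" for a
    using A that by (auto simp: subset_eq)
  then show "\<exists>A :: 'a set set. countable A \<and> A \<subseteq> sets lebesgue \<and> \<Union> A = space lebesgue \<and>
      (\<forall>a\<in>A. emeasure lebesgue a \<noteq> (\<infinity> :: ennreal))"
    using A(1,3) by (metis space_completion subsetI)
qed

text \<open>A Lebesgue measurable \<open>p\<close> need not be measurable for the product of \<open>lebesgue_on \<Omega>\<close> with itself.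
  The Borel version \<open>p'\<close> is, and it turns the iterated integral of the Gagliardo modular into an
  integral over the product measure.\<close>

locale frac_space =
  fixes \<Omega> :: "'a::euclidean_space set"
    and s :: real and q :: "'a \<Rightarrow> real" and p :: "'a \<times> 'a \<Rightarrow> real"
    and P :: real and p' :: "'a \<times> 'a \<Rightarrow> real"
  assumes open_\<Omega>: "open \<Omega>"
    and q_measurable [measurable]: "q \<in> borel_measurable (lebesgue_on \<Omega>)"
    and q_bounds: "AE x in lebesgue_on \<Omega>. 1 \<le> q x \<and> q x \<le> P"
    and p'_borel: "p' \<in> borel_measurable borel"
    and p'_bounds: "1 \<le> p' z \<and> p' z \<le> P"
    and p_eq_p': "AE y in lebesgue_on \<Omega>. AE x in lebesgue_on \<Omega>. p (x, y) = p' (x, y)"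
begin

abbreviation "N \<equiv> lebesgue_on \<Omega>"
abbreviation "\<rho> \<equiv> frac_modular \<Omega> s q p"
abbreviation "W \<equiv> frac_sobolev \<Omega> s q p"
abbreviation "W0 \<equiv> frac_sobolev_tilde \<Omega> s q p"

lemma P_ge_1: "1 \<le> P"
  using p'_bounds order_trans by blast

lemma \<Omega>_sets: "\<Omega> \<in> sets lebesgue"
  using open_\<Omega> by auto

sublocale N: sigma_finite_measure N
  using sigma_finite_measure_restrict_space[OF sigma_finite_lebesgue \<Omega>_sets] .

sublocale NN: pair_sigma_finite N N ..

lemma id_measurable [measurable]: "(\<lambda>x. x) \<in> N \<rightarrow>\<^sub>M borel"
  by (intro measurable_restrict_space1) (simp add: measurable_completion)

lemma fst_measurable [measurable]: "fst \<in> N \<Otimes>\<^sub>M N \<rightarrow>\<^sub>M borel"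
  using measurable_compose[OF measurable_fst id_measurable] by simp

lemma snd_measurable [measurable]: "snd \<in> N \<Otimes>\<^sub>M N \<rightarrow>\<^sub>M borel"
  using measurable_compose[OF measurable_snd id_measurable] by simp

lemma p'_measurable [measurable]: "p' \<in> borel_measurable (N \<Otimes>\<^sub>M N)"
proof -
  have "(\<lambda>z. (fst z, snd z)) \<in> N \<Otimes>\<^sub>M N \<rightarrow>\<^sub>M borel \<Otimes>\<^sub>M borel"
    by measurable
  then have "(\<lambda>z. z) \<in> N \<Otimes>\<^sub>M N \<rightarrow>\<^sub>M borel"
    by (simp add: borel_prod)
  from measurable_compose[OF this p'_borel] show ?thesis .
qed

section \<open>The fractional modular as a sum of two power modulars\<close>

text \<open>On the diagonal the value is \<open>inverse 0 = 0\<close>, in agreement with the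
  convention in the Gagliardo integrand.\<close>

definition kernel :: "'a \<times> 'a \<Rightarrow> real"
  where "kernel z = inverse (norm (fst z - snd z) powr (real DIM('a) + s * p' z))"

definition difference :: "('a \<Rightarrow> real) \<Rightarrow> 'a \<times> 'a \<Rightarrow> real"
  where "difference u z = u (fst z) - u (snd z)"

lemma kernel_measurable [measurable]: "kernel \<in> borel_measurable (N \<Otimes>\<^sub>M N)"
  unfolding kernel_def by measurable

lemma kernel_nonneg: "0 \<le> kernel z"
  by (simp add: kernel_def)

lemma difference_measurable [measurable]:
  assumes [measurable]: "u \<in> borel_measurable N"
  shows "difference u \<in> borel_measurable (N \<Otimes>\<^sub>M N)"
  unfolding difference_def by measurable

lemma kernel_bounds: "AE z in N \<Otimes>\<^sub>M N. 1 \<le> p' z \<and> p' z \<le> P \<and> 0 \<le> kernel z"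
  using p'_bounds kernel_nonneg by simp

lemma q_bounds': "AE x in N. 1 \<le> q x \<and> q x \<le> P \<and> 0 \<le> (1::real)"
  using q_bounds by simp

lemma Lq_modular_eq: "Lq_modular \<Omega> q u = pow_modular N q (\<lambda>_. 1) u"
  by (simp add: Lq_modular_def pow_modular_def)

lemma gagliardo_modular_eq:
  assumes [measurable]: "u \<in> borel_measurable N"
  shows "gagliardo_modular \<Omega> s p u = pow_modular (N \<Otimes>\<^sub>M N) p' kernel (difference u)"
proof -
  have "gagliardo_modular \<Omega> s p u
    = (\<integral>\<^sup>+y. \<integral>\<^sup>+x. ennreal (\<bar>difference u (x, y)\<bar> powr p' (x, y) * kernel (x, y)) \<partial>N \<partial>N)"
    unfolding gagliardo_modular_def
  proof (rule nn_integral_cong_AE, use p_eq_p' in eventually_elim)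
    case (elim y)
    then show ?case
      by (intro nn_integral_cong_AE, eventually_elim)
        (simp add: difference_def kernel_def divide_inverse)
  qed
  also have "\<dots> = pow_modular (N \<Otimes>\<^sub>M N) p' kernel (difference u)"
    unfolding pow_modular_def by (rule NN.nn_integral_snd) measurable
  finally show ?thesis .
qed

lemma modular_eq:
  assumes "u \<in> borel_measurable N"
  shows "\<rho> u = pow_modular N q (\<lambda>_. 1) u + pow_modular (N \<Otimes>\<^sub>M N) p' kernel (difference u)"
  using assms by (simp add: frac_modular_def Lq_modular_eq gagliardo_modular_eq)

text \<open>The bad pairs lie in two strips over a null set \<open>B\<close>, one for each
  coordinate, and both strips are null. This carries almost everywhere convergence of functions over
  to their differences.\<close>

lemma AE_pairI:
  assumes "AE x in N. Q x"
  shows "AE z in N \<Otimes>\<^sub>M N. Q (fst z) \<and> Q (snd z)"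
proof -
  obtain B where B: "B \<in> null_sets N" "{x \<in> space N. \<not> Q x} \<subseteq> B"
    using assms by (auto simp: eventually_ae_filter)
  have "B \<times> space N \<union> space N \<times> B \<in> null_sets (N \<Otimes>\<^sub>M N)"
    using B(1) by (intro null_sets.Un N.times_in_null_sets1 N.times_in_null_sets2) auto
  moreover have "{z \<in> space (N \<Otimes>\<^sub>M N). \<not> (Q (fst z) \<and> Q (snd z))} \<subseteq> B \<times> space N \<union> space N \<times> B"
    using B(2) by (auto simp: space_pair_measure)
  ultimately show ?thesis
    by (rule AE_I')
qed

lemma modular_suminf_le:
  assumes [measurable]: "\<And>k. f k \<in> borel_measurable N" "g \<in> borel_measurable N"
    and g: "AE x in N. (\<lambda>k. f k x) sums g x"
  shows "\<rho> g \<le> (\<Sum>k. ennreal (2 powr (real (Suc k) * P)) * \<rho> (f k))"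
proof -
  have "AE z in N \<Otimes>\<^sub>M N. (\<lambda>k. difference (f k) z) sums difference g z"
    using AE_pairI[OF g] by eventually_elim (simp add: difference_def sums_diff)
  then have "pow_modular (N \<Otimes>\<^sub>M N) p' kernel (difference g)
    \<le> (\<Sum>k. ennreal (2 powr (real (Suc k) * P)) * pow_modular (N \<Otimes>\<^sub>M N) p' kernel (difference (f k)))"
    by (intro pow_modular_suminf_le[OF kernel_bounds]) measurable
  moreover have "pow_modular N q (\<lambda>_. 1) g
    \<le> (\<Sum>k. ennreal (2 powr (real (Suc k) * P)) * pow_modular N q (\<lambda>_. 1) (f k))"
    using g by (intro pow_modular_suminf_le[OF q_bounds']) measurable
  ultimately show ?thesis
    by (simp add: modular_eq distrib_left suminf_add[symmetric] add_mono)
qed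

text \<open>The part of the modular without differences suffices, since its weight is 1.\<close>

lemma modular_AE_summable:
  assumes [measurable]: "\<And>k. f k \<in> borel_measurable N"
    and fin: "(\<Sum>k. ennreal (2 powr (real (Suc k) * P)) * \<rho> (f k)) < \<infinity>"
  shows "AE x in N. summable (\<lambda>k. \<bar>f k x\<bar>)"
proof (rule AE_summable_of_pow_modular[OF q_bounds])
  have "(\<Sum>k. ennreal (2 powr (real (Suc k) * P)) * pow_modular N q (\<lambda>_. 1) (f k))
    \<le> (\<Sum>k. ennreal (2 powr (real (Suc k) * P)) * \<rho> (f k))"
    by (intro suminf_le mult_left_mono) (auto simp: modular_eq)
  then show "(\<Sum>k. ennreal (2 powr (real (Suc k) * P)) * pow_modular N q (\<lambda>_. 1) (f k)) < \<infinity>"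
    using fin by order
qed measurable

lemma modular_cmult_le:
  assumes [measurable]: "u \<in> borel_measurable N" and c: "0 \<le> c"
    and le: "\<And>r. 1 \<le> r \<Longrightarrow> r \<le> P \<Longrightarrow> \<bar>t\<bar> powr r \<le> c"
  shows "\<rho> (\<lambda>x. t * u x) \<le> ennreal c * \<rho> u"
proof -
  have "difference (\<lambda>x. t * u x) = (\<lambda>z. t * difference u z)"
    by (auto simp: difference_def algebra_simps)
  then show ?thesis
    by (simp add: modular_eq distrib_left add_mono
        pow_modular_cmult_le[OF q_bounds' c le] pow_modular_cmult_le[OF kernel_bounds c le])
qed

lemma modular_abs_le:
  assumes [measurable]: "u \<in> borel_measurable N"
  shows "\<rho> (\<lambda>x. \<bar>u x\<bar>) \<le> \<rho> u"
  by (auto simp: modular_eq difference_def intro!: add_mono pow_modular_mono[OF q_bounds'] pow_modular_mono[OF kernel_bounds])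

lemma modular_zero: "\<rho> (\<lambda>_. 0) = 0"
  by (simp add: modular_eq pow_modular_def difference_def)

text \<open>This is the countable estimate for the sequence \<open>u, v, 0, 0, ...\<close>, whose
  two relevant weights \<open>2 powr P\<close> and \<open>2 powr (2 * P)\<close> are at most
  \<open>4 powr P\<close>.\<close>

lemma modular_add_le:
  assumes [measurable]: "u \<in> borel_measurable N" "v \<in> borel_measurable N"
  shows "\<rho> (\<lambda>x. u x + v x) \<le> ennreal (4 powr P) * (\<rho> u + \<rho> v)"
proof -
  define f where "f k = (if k = 0 then u else if k = 1 then v else (\<lambda>_. 0))" for k :: nat
  have [measurable]: "f k \<in> borel_measurable N" for k
    by (auto simp: f_def)
  have "(\<lambda>k. f k x) sums (\<Sum>k\<in>{0,1}. f k x)" for x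
    by (rule sums_finite) (auto simp: f_def)
  then have "(\<lambda>k. f k x) sums (u x + v x)" for x
    by (simp add: f_def)
  then have "\<rho> (\<lambda>x. u x + v x) \<le> (\<Sum>k. ennreal (2 powr (real (Suc k) * P)) * \<rho> (f k))"
    by (intro modular_suminf_le) auto
  also have "\<dots> = (\<Sum>k\<in>{0,1}. ennreal (2 powr (real (Suc k) * P)) * \<rho> (f k))"
    by (rule suminf_finite) (auto simp: f_def modular_zero)
  also have "\<dots> = ennreal (2 powr P) * \<rho> u + ennreal (2 powr (2 * P)) * \<rho> v"
    by (simp add: f_def)
  also have "\<dots> \<le> ennreal (4 powr P) * \<rho> u + ennreal (4 powr P) * \<rho> v"
    using P_ge_1 powr_powr[of 2 2 P]
    by (intro add_mono mult_right_mono ennreal_leI) (auto intro: powr_mono2)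
  finally show ?thesis by (simp add: distrib_left)
qed

lemma modular_minus:
  assumes "u \<in> borel_measurable N"
  shows "\<rho> (\<lambda>x. - u x) \<le> \<rho> u"
  using modular_cmult_le[OF assms, of 1 "-1"] by simp

lemma modular_diff_le:
  assumes [measurable]: "u \<in> borel_measurable N" "v \<in> borel_measurable N"
  shows "\<rho> (\<lambda>x. u x - v x) \<le> ennreal (4 powr P) * (\<rho> u + \<rho> v)"
proof -
  have "\<rho> (\<lambda>x. u x - v x) \<le> ennreal (4 powr P) * (\<rho> u + \<rho> (\<lambda>x. - v x))"
    using modular_add_le[of u "\<lambda>x. - v x"] by simp
  also have "\<dots> \<le> ennreal (4 powr P) * (\<rho> u + \<rho> v)"
    by (intro mult_left_mono add_left_mono modular_minus) auto
  finally show ?thesis .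
qed

section \<open>Comparison of the norm with the modular\<close>

text \<open>Absorbing \<open>t powr p (x, y)\<close> into the difference exhibits the seminorm as
  the Luxemburg functional of the Gagliardo modular, parallel to \<open>Lq_norm\<close>.\<close>

lemma gagliardo_seminorm_eq:
  "gagliardo_seminorm \<Omega> s p u
    = (INF t\<in>{t::real. 0 < t \<and> gagliardo_modular \<Omega> s p (\<lambda>x. u x / t) \<le> 1}. ennreal t)"
proof -
  have "\<bar>u x / t - u y / t\<bar> powr r / n = \<bar>u x - u y\<bar> powr r / (t powr r * n)"
    if "0 < t" for x y t r n
    using that by (simp add: diff_divide_distrib[symmetric] powr_divide)
  then have "{t::real. 0 < t \<and> gagliardo_modular \<Omega> s p (\<lambda>x. u x / t) \<le> 1}
    = {t::real. 0 < t \<and>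
        (\<integral>\<^sup>+y. \<integral>\<^sup>+x. ennreal (\<bar>u x - u y\<bar> powr p (x, y)
            / (t powr p (x, y) * norm (x - y) powr (real DIM('a) + s * p (x, y)))) \<partial>N \<partial>N) \<le> 1}"
    unfolding gagliardo_modular_def by (intro Collect_cong conj_cong refl) simp
  then show ?thesis
    unfolding gagliardo_seminorm_def by simp
qed

text \<open>For \<open>0 < t < 1\<close> and exponents at least 1, \<open>t powr r \<le> t\<close>;
  an admissible scale \<open>t < e\<close> therefore bounds each of the two parts by
  \<open>e\<close>.\<close>

lemma modular_le_of_norm:
  assumes [measurable]: "u \<in> borel_measurable N" and e: "0 < e" "e \<le> 1"
    and less: "frac_norm \<Omega> s q p u < ennreal e"
  shows "\<rho> u \<le> ennreal (2 * e)"
proof -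
  have "Lq_norm \<Omega> q u < ennreal e" "gagliardo_seminorm \<Omega> s p u < ennreal e"
    using less unfolding frac_norm_def
    by (meson order.strict_trans1 add_increasing add_increasing2 order_refl zero_le)+
  then obtain a b where a: "0 < a" "a < e" "Lq_modular \<Omega> q (\<lambda>x. u x / a) \<le> 1"
    and b: "0 < b" "b < e" "gagliardo_modular \<Omega> s p (\<lambda>x. u x / b) \<le> 1"
    unfolding Lq_norm_def gagliardo_seminorm_eq INF_less_iff using e by (auto simp: ennreal_less_iff)
  have small: "\<bar>t\<bar> powr r \<le> t" if "0 < t" "t < e" "1 \<le> r" for t r :: real
    using powr_mono'[of 1 r t] that e by auto
  have scale: "pow_modular M r K U \<le> ennreal e"
    if "AE z in M. 1 \<le> r z \<and> r z \<le> P \<and> 0 \<le> K z" "0 < t" "t < e"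
      "pow_modular M r K (\<lambda>z. U z / t) \<le> 1"
      "U \<in> borel_measurable M" "r \<in> borel_measurable M" "K \<in> borel_measurable M"
    for M :: "'c measure" and r K U t
  proof -
    have "pow_modular M r K U \<le> ennreal t * pow_modular M r K (\<lambda>z. U z / t)"
      using pow_modular_cmult_le[OF that(1), of t t "\<lambda>z. U z / t"] that small by simp
    also have "\<dots> \<le> ennreal t * 1"
      using that by (intro mult_left_mono) auto
    also have "\<dots> \<le> ennreal e" using that by (simp add: ennreal_leI)
    finally show ?thesis .
  qed
  have "pow_modular N q (\<lambda>_. 1) u \<le> ennreal e"
    using a by (intro scale[OF q_bounds' a(1,2)]) (auto simp: Lq_modular_eq)
  moreover have "difference (\<lambda>x. u x / b) = (\<lambda>z. difference u z / b)"
    by (auto simp: difference_def diff_divide_distrib)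
  then have "pow_modular (N \<Otimes>\<^sub>M N) p' kernel (difference u) \<le> ennreal e"
    using b by (intro scale[OF kernel_bounds b(1,2)]) (auto simp: gagliardo_modular_eq)
  ultimately have "\<rho> u \<le> ennreal e + ennreal e"
    by (simp add: modular_eq add_mono)
  then show ?thesis using e by (simp add: ennreal_plus[symmetric] del: ennreal_plus)
qed

text \<open>Division by \<open>t \<le> 1\<close> enlarges the modular at most by
  \<open>(1 / t) powr P\<close>, so \<open>t\<close> is admissible in both infima.\<close>

lemma norm_le_of_modular:
  assumes [measurable]: "u \<in> borel_measurable N" and t: "0 < t" "t \<le> 1"
    and le: "\<rho> u \<le> ennreal (t powr P)"
  shows "frac_norm \<Omega> s q p u \<le> ennreal (2 * t)"
proof -
  have "\<bar>1 / t\<bar> powr r \<le> (1 / t) powr P" if "r \<le> P" for r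
    using t that by (auto intro!: powr_mono)
  then have "\<rho> (\<lambda>x. (1 / t) * u x) \<le> ennreal ((1 / t) powr P) * \<rho> u"
    by (intro modular_cmult_le) auto
  also have "\<dots> \<le> ennreal ((1 / t) powr P) * ennreal (t powr P)"
    using le by (intro mult_left_mono) auto
  also have "\<dots> = 1"
    using t by (simp add: ennreal_mult'[symmetric] powr_mult[symmetric])
  finally have "\<rho> (\<lambda>x. u x / t) \<le> 1" by simp
  then have "Lq_modular \<Omega> q (\<lambda>x. u x / t) \<le> 1" "gagliardo_modular \<Omega> s p (\<lambda>x. u x / t) \<le> 1"
    unfolding frac_modular_def by (auto intro: order_trans[rotated] add_increasing add_increasing2)
  then have "Lq_norm \<Omega> q u \<le> ennreal t" "gagliardo_seminorm \<Omega> s p u \<le> ennreal t"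
    unfolding Lq_norm_def gagliardo_seminorm_eq using t by (auto intro!: INF_lower)
  then have "frac_norm \<Omega> s q p u \<le> ennreal t + ennreal t"
    unfolding frac_norm_def by (rule add_mono)
  then show ?thesis using t by (simp add: ennreal_plus[symmetric] del: ennreal_plus)
qed

text \<open>The two comparisons turn approximation in norm into approximation in modular, the only
  form used from here on.\<close>

lemma tilde_iff:
  "u \<in> W0 \<longleftrightarrow> u \<in> W \<and> (\<forall>e>0::real. \<exists>v \<in> W \<inter> Cc_closure \<Omega>. \<rho> (\<lambda>x. u x - v x) \<le> ennreal e)"
    (is "_ \<longleftrightarrow> _ \<and> ?R")
proof (cases "u \<in> W")
  case True
  have m: "(\<lambda>x. u x - v x) \<in> borel_measurable N" if "v \<in> W" for v
    using True that by (auto simp: frac_sobolev_def)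
  have "(\<forall>e>0::real. \<exists>v \<in> W \<inter> Cc_closure \<Omega>. frac_norm \<Omega> s q p (\<lambda>x. u x - v x) < ennreal e) \<longleftrightarrow> ?R"
    (is "?L \<longleftrightarrow> _")
  proof (intro iffI allI impI)
    fix e :: real assume L: ?L and "0 < e"
    define d where "d = min 1 (e / 2)"
    have d: "0 < d" "d \<le> 1" "2 * d \<le> e" using \<open>0 < e\<close> by (auto simp: d_def)
    then obtain v where v: "v \<in> W \<inter> Cc_closure \<Omega>" "frac_norm \<Omega> s q p (\<lambda>x. u x - v x) < ennreal d"
      using L by blast
    have "\<rho> (\<lambda>x. u x - v x) \<le> ennreal (2 * d)"
      using v m d by (intro modular_le_of_norm) auto
    also have "\<dots> \<le> ennreal e" using d by (simp add: ennreal_leI)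
    finally show "\<exists>v \<in> W \<inter> Cc_closure \<Omega>. \<rho> (\<lambda>x. u x - v x) \<le> ennreal e" using v by blast
  next
    fix e :: real assume R: ?R and "0 < e"
    \<comment> \<open>A third instead of a half, because the norm has to stay strictly below
      \<open>e\<close>.\<close>
    define d where "d = min 1 (e / 3)"
    have d: "0 < d" "d \<le> 1" "2 * d < e" using \<open>0 < e\<close> by (auto simp: d_def)
    then have "0 < d powr P" by simp
    then obtain v where v: "v \<in> W \<inter> Cc_closure \<Omega>" "\<rho> (\<lambda>x. u x - v x) \<le> ennreal (d powr P)"
      using R by blast
    have "frac_norm \<Omega> s q p (\<lambda>x. u x - v x) \<le> ennreal (2 * d)"
      using v m d by (intro norm_le_of_modular) auto
    also have "\<dots> < ennreal e" using d by (simp add: ennreal_less_iff)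
    finally show "\<exists>v \<in> W \<inter> Cc_closure \<Omega>. frac_norm \<Omega> s q p (\<lambda>x. u x - v x) < ennreal e" using v by blast
  qed
  then show ?thesis using True by (simp add: frac_sobolev_tilde_def)
qed (simp add: frac_sobolev_tilde_def)

end

section \<open>Stability of the function spaces under algebraic operations\<close>

lemma compact_closure_subset:
  fixes S T :: "'a::heine_borel set"
  assumes "compact (closure T)" "S \<subseteq> T"
  shows "compact (closure S)"
  using assms by (meson bounded_closure bounded_subset closure_subset compact_closure compact_imp_bounded)

text \<open>The condition \<open>h 0 0 = 0\<close> confines the support to the union of the two
  supports. Sums, multiples and absolute values are instances.\<close>

lemma Cc_closure_combine:
  assumes "u \<in> Cc_closure \<Omega>" "v \<in> Cc_closure \<Omega>"
    and "continuous_on UNIV (\<lambda>z. h (fst z) (snd z))" "h 0 0 = (0::real)"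
  shows "(\<lambda>x. h (u x) (v x)) \<in> Cc_closure \<Omega>"
proof -
  have "continuous_on (closure \<Omega>) (\<lambda>x. (u x, v x))"
    using assms by (auto simp: Cc_closure_def intro: continuous_on_Pair)
  then have "continuous_on (closure \<Omega>) (\<lambda>x. h (u x) (v x))"
    using continuous_on_compose2[OF assms(3), of "closure \<Omega>" "\<lambda>x. (u x, v x)"] by simp
  moreover have "compact (closure ({x \<in> closure \<Omega>. u x \<noteq> 0} \<union> {x \<in> closure \<Omega>. v x \<noteq> 0}))"
    using assms by (auto simp: Cc_closure_def intro: compact_Un)
  then have "compact (closure {x \<in> closure \<Omega>. h (u x) (v x) \<noteq> 0})"
    by (rule compact_closure_subset) (use assms(4) in auto)
  ultimately show ?thesis by (simp add: Cc_closure_def)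
qed

lemma Cc_closure_zero: "(\<lambda>_. 0) \<in> Cc_closure \<Omega>"
  by (simp add: Cc_closure_def)

context frac_space
begin

abbreviation "Wc \<equiv> W \<inter> Cc_closure \<Omega>"

lemma W_measurable: "u \<in> W \<Longrightarrow> u \<in> borel_measurable N"
  by (simp add: frac_sobolev_def)

lemma W0_subset: "W0 \<subseteq> W"
  by (auto simp: frac_sobolev_tilde_def)

lemma W_modular_le:
  assumes "u \<in> borel_measurable N" "\<rho> u \<le> a" "a < \<infinity>"
  shows "u \<in> W"
  using assms by (auto simp: frac_sobolev_def intro: order.strict_trans1)

lemma W_add:
  assumes "u \<in> W" "v \<in> W"
  shows "(\<lambda>x. u x + v x) \<in> W"
  using assms
  by (intro W_modular_le[OF _ modular_add_le])
    (auto simp: frac_sobolev_def ennreal_mult_less_top)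

lemma W_cmult:
  assumes "u \<in> W"
  shows "(\<lambda>x. t * u x) \<in> W"
proof (rule W_modular_le)
  have "\<bar>t\<bar> powr r \<le> max 1 \<bar>t\<bar> powr P" if "1 \<le> r" "r \<le> P" for r
    using powr_mono2[of r "\<bar>t\<bar>" "max 1 \<bar>t\<bar>"] powr_mono[of r P "max 1 \<bar>t\<bar>"] that by auto
  then show "\<rho> (\<lambda>x. t * u x) \<le> ennreal (max 1 \<bar>t\<bar> powr P) * \<rho> u"
    using assms by (intro modular_cmult_le W_measurable) auto
qed (use assms in \<open>auto simp: frac_sobolev_def ennreal_mult_less_top\<close>)

lemma Wc_zero: "(\<lambda>_. 0) \<in> Wc"
  by (simp add: frac_sobolev_def modular_zero Cc_closure_zero)

lemma Wc_add:
  assumes "u \<in> Wc" "v \<in> Wc"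
  shows "(\<lambda>x. u x + v x) \<in> Wc"
proof -
  have "continuous_on UNIV (\<lambda>z::real \<times> real. fst z + snd z)"
    by (intro continuous_intros)
  then show ?thesis
    using assms W_add Cc_closure_combine[of u \<Omega> v "(+)"] by auto
qed

lemma Wc_cmult:
  assumes "u \<in> Wc"
  shows "(\<lambda>x. t * u x) \<in> Wc"
proof -
  have "continuous_on UNIV (\<lambda>z::real \<times> real. t * fst z)"
    by (intro continuous_intros)
  then show ?thesis
    using assms W_cmult Cc_closure_combine[of u \<Omega> u "\<lambda>a b. t * a"] by auto
qed

lemma Wc_diff:
  assumes "u \<in> Wc" "v \<in> Wc"
  shows "(\<lambda>x. u x - v x) \<in> Wc"
  using Wc_add[OF assms(1) Wc_cmult[OF assms(2), of "-1"]] by simp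

lemma Wc_abs:
  assumes "u \<in> Wc"
  shows "(\<lambda>x. \<bar>u x\<bar>) \<in> Wc"
proof -
  have "(\<lambda>x. \<bar>u x\<bar>) \<in> W"
    using assms by (intro W_modular_le[OF _ modular_abs_le]) (auto simp: frac_sobolev_def)
  moreover have "continuous_on UNIV (\<lambda>z::real \<times> real. \<bar>fst z\<bar>)"
    by (intro continuous_intros)
  ultimately show ?thesis
    using assms Cc_closure_combine[of u \<Omega> u "\<lambda>a b. \<bar>a\<bar>"] by auto
qed

lemma Wc_sum:
  assumes "\<And>k. v k \<in> Wc"
  shows "(\<lambda>x. \<Sum>k<(n::nat). v k x) \<in> Wc"
proof (induction n)
  case 0
  then show ?case using Wc_zero by simp
next
  case (Suc n)
  then show ?case using Wc_add[OF Suc assms[of n]] by simp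
qed

lemma W0_add:
  assumes "u \<in> W0" "v \<in> W0"
  shows "(\<lambda>x. u x + v x) \<in> W0"
  unfolding tilde_iff
proof (intro conjI allI impI)
  show "(\<lambda>x. u x + v x) \<in> W"
    using assms W0_subset W_add by auto
  fix e :: real assume "0 < e"
  \<comment> \<open>Chosen so that \<open>4 powr P * (d + d) = e\<close>.\<close>
  define d where "d = e / (2 * 4 powr P)"
  have "0 < d" using \<open>0 < e\<close> by (simp add: d_def)
  then obtain u' v' where u': "u' \<in> Wc" "\<rho> (\<lambda>x. u x - u' x) \<le> ennreal d"
    and v': "v' \<in> Wc" "\<rho> (\<lambda>x. v x - v' x) \<le> ennreal d"
    using assms unfolding tilde_iff by meson
  have [measurable]: "u \<in> borel_measurable N" "v \<in> borel_measurable N"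
      "u' \<in> borel_measurable N" "v' \<in> borel_measurable N"
    using assms u' v' W0_subset W_measurable by auto
  have "\<rho> (\<lambda>x. u x + v x - (u' x + v' x)) = \<rho> (\<lambda>x. (u x - u' x) + (v x - v' x))"
    by (simp add: algebra_simps)
  also have "\<dots> \<le> ennreal (4 powr P) * (\<rho> (\<lambda>x. u x - u' x) + \<rho> (\<lambda>x. v x - v' x))"
    by (rule modular_add_le) measurable
  also have "\<dots> \<le> ennreal (4 powr P) * (ennreal d + ennreal d)"
    by (intro mult_left_mono add_mono u' v') auto
  also have "\<dots> = ennreal e"
    using \<open>0 < d\<close> by (simp add: d_def ennreal_mult'[symmetric] ennreal_plus[symmetric] del: ennreal_plus)
  finally show "\<exists>w\<in>Wc. \<rho> (\<lambda>x. u x + v x - w x) \<le> ennreal e"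
    using Wc_add[OF u'(1) v'(1)] by (rule bexI)
qed

section \<open>Series with summable weighted modulars\<close>

lemma modular_sums_le:
  assumes "\<And>k. f k \<in> borel_measurable N" "g \<in> borel_measurable N"
    and "AE x in N. (\<lambda>k. f k x) sums g x"
    and a: "\<And>k. ennreal (2 powr (real (Suc k) * P)) * \<rho> (f k) \<le> ennreal (a k)" "\<And>k. 0 \<le> a k" "summable a"
  shows "\<rho> g \<le> ennreal (\<Sum>k. a k)"
proof -
  have "\<rho> g \<le> (\<Sum>k. ennreal (2 powr (real (Suc k) * P)) * \<rho> (f k))"
    using assms(1-3) by (rule modular_suminf_le)
  also have "\<dots> \<le> (\<Sum>k. ennreal (a k))"
    by (intro suminf_le a) auto
  also have "\<dots> = ennreal (\<Sum>k. a k)"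
    using a by (intro suminf_ennreal2) auto
  finally show ?thesis .
qed

lemma AE_summable_of_bound:
  assumes "\<And>k. f k \<in> borel_measurable N"
    and a: "\<And>k. ennreal (2 powr (real (Suc k) * P)) * \<rho> (f k) \<le> ennreal (a k)" "\<And>k. 0 \<le> a k" "summable a"
  shows "AE x in N. summable (\<lambda>k. \<bar>f k x\<bar>)"
proof (rule modular_AE_summable[OF assms(1)])
  have "(\<Sum>k. ennreal (2 powr (real (Suc k) * P)) * \<rho> (f k)) \<le> (\<Sum>k. ennreal (a k))"
    by (intro suminf_le a) auto
  also have "\<dots> = ennreal (\<Sum>k. a k)"
    using a by (intro suminf_ennreal2) auto
  also have "\<dots> < \<infinity>" by simp
  finally show "(\<Sum>k. ennreal (2 powr (real (Suc k) * P)) * \<rho> (f k)) < \<infinity>" .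
qed

text \<open>For tails of series: the term with index \<open>k + n\<close> moves to position
  \<open>k\<close>, where the weight is no larger, so bounds made for the full series
  persist.\<close>

lemma weight_mono:
  "ennreal (2 powr (real (Suc k) * P)) * x \<le> ennreal (2 powr (real (Suc (k + n)) * P)) * x"
  using P_ge_1 by (intro mult_right_mono ennreal_leI powr_mono) (auto simp: mult_right_mono)

text \<open>The partial sums are in \<open>Wc\<close>, and the modulars of the tails are dominated
  by the tails of \<open>a\<close>. Hence the sum is in \<open>W0\<close> without an appeal to
  completeness of the space.\<close>

lemma abs_series:
  assumes v: "\<And>k. v k \<in> Wc"
    and a: "\<And>k. ennreal (2 powr (real (Suc k) * P)) * \<rho> (v k) \<le> ennreal (a k)" "\<And>k. 0 \<le> a k" "summable a"
  defines "g \<equiv> \<lambda>x. \<Sum>k. \<bar>v k x\<bar>"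
  shows "AE x in N. summable (\<lambda>k. \<bar>v k x\<bar>)" "g \<in> W0" "\<rho> g \<le> ennreal (\<Sum>k. a k)"
proof -
  have [measurable]: "v k \<in> borel_measurable N" for k
    using v W_measurable by auto
  have g_meas[measurable]: "g \<in> borel_measurable N"
    unfolding g_def by measurable
  show sm: "AE x in N. summable (\<lambda>k. \<bar>v k x\<bar>)"
    by (rule AE_summable_of_bound[OF _ a]) measurable
  have abs_le: "ennreal (2 powr (real (Suc k) * P)) * \<rho> (\<lambda>x. \<bar>v (k + n) x\<bar>) \<le> ennreal (a (k + n))" for k n
  proof -
    have "ennreal (2 powr (real (Suc k) * P)) * \<rho> (\<lambda>x. \<bar>v (k + n) x\<bar>)
      \<le> ennreal (2 powr (real (Suc k) * P)) * \<rho> (v (k + n))"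
      by (intro mult_left_mono modular_abs_le) auto
    also have "\<dots> \<le> ennreal (2 powr (real (Suc (k + n)) * P)) * \<rho> (v (k + n))"
      by (rule weight_mono)
    also have "\<dots> \<le> ennreal (a (k + n))" by (rule a)
    finally show ?thesis .
  qed
  have tail: "\<rho> (\<lambda>x. g x - (\<Sum>k<n. \<bar>v k x\<bar>)) \<le> ennreal (\<Sum>k. a (k + n))" for n
  proof (rule modular_sums_le[OF _ _ _ abs_le])
    show "AE x in N. (\<lambda>k. \<bar>v (k + n) x\<bar>) sums (g x - (\<Sum>k<n. \<bar>v k x\<bar>))"
      using sm by eventually_elim (auto simp: g_def intro!: sums_split_initial_segment summable_sums)
  qed (use a in \<open>auto intro: summable_ignore_initial_segment\<close>)
  show \<rho>g: "\<rho> g \<le> ennreal (\<Sum>k. a k)"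
    using tail[of 0] by simp
  show "g \<in> W0"
    unfolding tilde_iff
  proof (intro conjI allI impI)
    show "g \<in> W" using \<rho>g by (rule W_modular_le[OF g_meas]) simp
    fix e :: real assume "0 < e"
    then obtain n where n: "norm (\<Sum>k. a (k + n)) < e"
      using suminf_exist_split[OF _ a(3)] by blast
    have "\<rho> (\<lambda>x. g x - (\<Sum>k<n. \<bar>v k x\<bar>)) \<le> ennreal e"
      using n by (intro order_trans[OF tail] ennreal_leI) auto
    moreover have "(\<lambda>x. \<Sum>k<n. \<bar>v k x\<bar>) \<in> Wc"
      by (intro Wc_sum Wc_abs v)
    ultimately show "\<exists>w\<in>Wc. \<rho> (\<lambda>x. g x - w x) \<le> ennreal e" by (rule bexI)
  qed
qed

section \<open>Rapid approximation and majorants\<close>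

text \<open>The factors are \<open>4 powr P\<close> from \<open>modular_diff_le\<close>, 2 for the
  errors of two consecutive approximants, and \<open>2 powr P\<close> from the weight having
  \<open>Suc k\<close> in place of \<open>k\<close>.\<close>

definition "approx_const = 2 * 8 powr P"

text \<open>The weights \<open>2\<^sup>-\<^sup>k\<^sup>(\<^sup>2\<^sup>P\<^sup>+\<^sup>1\<^sup>)\<close> absorb a factor \<open>2\<^sup>k\<^sup>P\<close> from the countable
  quasi-subadditivity of the modular and another one from multiplying the differences by \<open>2\<^sup>k\<close>.\<close>

lemma rapid_approximation:
  assumes u: "u \<in> W0" and \<eta>: "0 < \<eta>" "\<rho> u \<le> ennreal \<eta>"
  obtains v where "v 0 = (\<lambda>_. 0)" "\<And>k. v k \<in> Wc"
    "\<And>k. ennreal (2 powr (real (Suc k) * P)) * \<rho> (\<lambda>x. 2 ^ k * (v (Suc k) x - v k x)) \<le> ennreal (approx_const * \<eta> * (1/2) ^ k)"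
    "AE x in N. (\<lambda>k. v k x) \<longlonglongrightarrow> u x"
proof -
  define \<delta> where "\<delta> k = 2 powr (- (real k * (2 * P + 1)))" for k
  have \<delta>: "0 < \<delta> k" "\<delta> 0 = 1" "\<delta> (Suc k) \<le> \<delta> k" for k
    using P_ge_1 by (auto simp: \<delta>_def algebra_simps)
  have "\<exists>w. w \<in> Wc \<and> \<rho> (\<lambda>x. u x - w x) \<le> ennreal (\<eta> * \<delta> k)" for k
    using u \<eta>(1) \<delta>(1)[of k] unfolding tilde_iff by (meson mult_pos_pos)
  then obtain w where w: "\<And>k. w k \<in> Wc" "\<And>k. \<rho> (\<lambda>x. u x - w k x) \<le> ennreal (\<eta> * \<delta> k)"
    by metis
  \<comment> \<open>Zero is good enough at stage 0 because \<open>\<rho> u \<le> \<eta>\<close> and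
    \<open>\<delta> 0 = 1\<close>. The differences of \<open>v\<close> then telescope to all of
    \<open>u\<close>, with modulars proportional to \<open>\<eta>\<close>.\<close>
  define v where "v k = (if k = 0 then (\<lambda>_. 0) else w k)" for k
  have v: "v k \<in> Wc" "\<rho> (\<lambda>x. u x - v k x) \<le> ennreal (\<eta> * \<delta> k)" for k
    using w \<eta> Wc_zero by (auto simp: v_def \<delta>)
  have [measurable]: "u \<in> borel_measurable N" "v k \<in> borel_measurable N" for k
    using u v W0_subset W_measurable by auto
  have pow: "(1/2::real) ^ k = 2 powr - real k" for k
    by (simp add: powr_minus powr_realpow power_divide inverse_eq_divide)
  have "ennreal (2 powr (real (Suc k) * P)) * \<rho> (\<lambda>x. 2 ^ k * (v (Suc k) x - v k x)) \<le> ennreal (approx_const * \<eta> * (1/2) ^ k)" for k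
  proof -
    have "\<rho> (\<lambda>x. v (Suc k) x - v k x) = \<rho> (\<lambda>x. (u x - v k x) - (u x - v (Suc k) x))"
      by simp
    also have "\<dots> \<le> ennreal (4 powr P) * (\<rho> (\<lambda>x. u x - v k x) + \<rho> (\<lambda>x. u x - v (Suc k) x))"
      by (rule modular_diff_le) measurable
    also have "\<dots> \<le> ennreal (4 powr P) * (ennreal (\<eta> * \<delta> k) + ennreal (\<eta> * \<delta> k))"
      using \<delta>(3)[of k] \<eta> by (intro mult_left_mono add_mono v order_trans[OF v(2)[of "Suc k"]] ennreal_leI) auto
    also have "\<dots> = ennreal (4 powr P * (2 * (\<eta> * \<delta> k)))"
      using \<eta> \<delta>(1)[of k] by (simp add: ennreal_mult'[symmetric] ennreal_plus[symmetric] less_imp_le del: ennreal_plus)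
    finally have 1: "\<rho> (\<lambda>x. v (Suc k) x - v k x) \<le> ennreal (4 powr P * (2 * (\<eta> * \<delta> k)))" .
    have "\<bar>2 ^ k\<bar> powr r \<le> 2 powr (real k * P)" if "r \<le> P" for r :: real
      using that by (simp add: powr_realpow[symmetric] powr_powr mult_left_mono)
    then have "\<rho> (\<lambda>x. 2 ^ k * (v (Suc k) x - v k x)) \<le> ennreal (2 powr (real k * P)) * \<rho> (\<lambda>x. v (Suc k) x - v k x)"
      by (intro modular_cmult_le) auto
    then have "ennreal (2 powr (real (Suc k) * P)) * \<rho> (\<lambda>x. 2 ^ k * (v (Suc k) x - v k x))
      \<le> ennreal (2 powr (real (Suc k) * P)) * (ennreal (2 powr (real k * P)) * ennreal (4 powr P * (2 * (\<eta> * \<delta> k))))"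
      by (intro mult_left_mono order_trans[OF _ mult_left_mono[OF 1]]) auto
    also have "\<dots> = ennreal (2 powr (real (Suc k) * P) * (2 powr (real k * P) * (4 powr P * (2 * (\<eta> * \<delta> k)))))"
      by (simp add: ennreal_mult')
    also have "2 powr (real (Suc k) * P) * (2 powr (real k * P) * (4 powr P * (2 * (\<eta> * \<delta> k)))) = approx_const * \<eta> * (1/2) ^ k"
    proof -
      have "4 powr P = 2 powr (2 * P)" "8 powr P = 2 powr (3 * P)"
        using powr_powr[of 2 2 P] powr_powr[of 2 3 P] by auto
      moreover have "2 powr (real (Suc k) * P) * 2 powr (real k * P) * 2 powr (2 * P) * \<delta> k = 2 powr (3 * P) * (1/2) ^ k"
        unfolding \<delta>_def pow powr_add[symmetric] by (simp add: algebra_simps)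
      ultimately show ?thesis by (simp add: approx_const_def)
    qed
    finally show ?thesis .
  qed
  \<comment> \<open>The errors themselves are summable almost everywhere, which gives pointwise
    convergence of the whole sequence without choosing a subsequence.\<close>
  moreover have "AE x in N. summable (\<lambda>k. \<bar>u x - v k x\<bar>)"
  proof (rule AE_summable_of_bound)
    fix k
    have "ennreal (2 powr (real (Suc k) * P)) * \<rho> (\<lambda>x. u x - v k x)
      \<le> ennreal (2 powr (real (Suc k) * P)) * ennreal (\<eta> * \<delta> k)"
      by (intro mult_left_mono v) auto
    also have "\<dots> = ennreal (\<eta> * 2 powr (P - real k * P - real k))"
      unfolding \<delta>_def by (simp add: ennreal_mult'[symmetric] powr_add[symmetric] algebra_simps)
    also have "\<dots> \<le> ennreal (\<eta> * (2 powr P * (1/2) ^ k))"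
      unfolding pow powr_add[symmetric] using \<eta> P_ge_1 by (intro ennreal_leI mult_left_mono powr_mono) auto
    finally show "ennreal (2 powr (real (Suc k) * P)) * \<rho> (\<lambda>x. u x - v k x) \<le> ennreal (\<eta> * (2 powr P * (1/2) ^ k))" .
  qed (use \<eta> in \<open>auto intro!: summable_mult summable_geometric\<close>)
  then have "AE x in N. (\<lambda>k. v k x) \<longlonglongrightarrow> u x"
  proof eventually_elim
    case (elim x)
    then have "(\<lambda>k. u x - v k x) \<longlonglongrightarrow> 0"
      using summable_LIMSEQ_zero tendsto_rabs_zero_iff by blast
    from tendsto_diff[OF tendsto_const[of "u x"] this] show ?case by simp
  qed
  ultimately show thesis
    using that[of v] v by (auto simp: v_def)
qed

text \<open>Since \<open>v 0 = 0\<close>, each \<open>\<bar>v n\<bar>\<close> is at most the sum of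
  the absolute differences; the factors \<open>2 ^ k \<ge> 1\<close> only enlarge it, and the bound
  passes to the limit \<open>u\<close>. The additional 2 is the sum of the geometric series.\<close>

lemma W0_majorant:
  assumes u: "u \<in> W0" and \<eta>: "0 < \<eta>" "\<rho> u \<le> ennreal \<eta>"
  obtains g where "g \<in> W0" "\<rho> g \<le> ennreal (2 * approx_const * \<eta>)" "AE x in N. \<bar>u x\<bar> \<le> g x"
proof -
  obtain v where v: "v 0 = (\<lambda>_. 0)" "\<And>k. v k \<in> Wc"
    "\<And>k. ennreal (2 powr (real (Suc k) * P)) * \<rho> (\<lambda>x. 2 ^ k * (v (Suc k) x - v k x)) \<le> ennreal (approx_const * \<eta> * (1/2) ^ k)"
    "AE x in N. (\<lambda>k. v k x) \<longlonglongrightarrow> u x"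
    using rapid_approximation[OF assms] by blast
  define f where "f k x = 2 ^ k * (v (Suc k) x - v k x)" for k x
  define g where "g x = (\<Sum>k. \<bar>f k x\<bar>)" for x
  have "f k \<in> Wc" for k
    unfolding f_def using v(2) by (intro Wc_cmult Wc_diff)
  moreover have "0 \<le> approx_const * \<eta> * (1/2) ^ k" for k
    using \<eta> by (simp add: approx_const_def)
  ultimately have sm: "AE x in N. summable (\<lambda>k. \<bar>f k x\<bar>)" and g: "g \<in> W0"
    and \<rho>g: "\<rho> g \<le> ennreal (\<Sum>k. approx_const * \<eta> * (1/2) ^ k)"
    using abs_series[of f "\<lambda>k. approx_const * \<eta> * (1/2) ^ k"] v(3)
    unfolding f_def[symmetric] g_def[abs_def] by (auto intro!: summable_mult summable_geometric)
  have "AE x in N. \<bar>u x\<bar> \<le> g x"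
    using sm v(4)
  proof eventually_elim
    case (elim x)
    have "\<bar>v n x\<bar> \<le> g x" for n
    proof -
      have "\<bar>v n x\<bar> = \<bar>\<Sum>k<n. v (Suc k) x - v k x\<bar>"
        using v(1) sum_lessThan_telescope[of "\<lambda>k. v k x" n] by simp
      also have "\<dots> \<le> (\<Sum>k<n. \<bar>v (Suc k) x - v k x\<bar>)" by (rule sum_abs)
      also have "\<dots> \<le> (\<Sum>k<n. \<bar>f k x\<bar>)"
        by (intro sum_mono) (auto simp: f_def abs_mult mult_le_cancel_right1)
      also have "\<dots> \<le> g x"
        unfolding g_def using elim by (intro sum_le_suminf) auto
      finally show ?thesis .
    qed
    then show ?case
      using tendsto_rabs[OF elim(2)] by (intro LIMSEQ_le_const2) auto
  qed
  moreover have "(\<Sum>k. approx_const * \<eta> * (1/2) ^ k) = 2 * approx_const * \<eta>"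
    by (subst suminf_mult) (auto simp: suminf_geometric summable_geometric)
  ultimately show thesis using that g \<rho>g by simp
qed

section \<open>Test functions for the relative capacity\<close>

lemma AE_N_iff: "(AE x in N. Q x) \<longleftrightarrow> (AE x in lebesgue. x \<in> \<Omega> \<longrightarrow> Q x)"
  using \<Omega>_sets by (subst AE_restrict_space_iff) auto

lemma rel_capacity_le:
  assumes "open U" "U \<subseteq> \<Omega>" "E \<subseteq> U" "g \<in> W0" "AE x in N. x \<in> U \<longrightarrow> 1 \<le> g x"
  shows "rel_capacity \<Omega> s q p E \<le> \<rho> g"
proof -
  have "AE x in lebesgue. x \<in> U \<inter> \<Omega> \<longrightarrow> 1 \<le> g x"
    using assms(5) unfolding AE_N_iff by eventually_elim auto
  then have "rel_capacity_open \<Omega> s q p U \<le> \<rho> g"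
    unfolding rel_capacity_open_def using assms(4) by (intro INF_lower) auto
  moreover have "openin (top_of_set (closure \<Omega>)) U"
    using assms(1,2) closure_subset by (intro open_subset) auto
  then have "rel_capacity \<Omega> s q p E \<le> rel_capacity_open \<Omega> s q p U"
    unfolding rel_capacity_def using assms(3) by (intro INF_lower) auto
  ultimately show ?thesis by order
qed

lemma rel_capacity_lessE:
  assumes "rel_capacity \<Omega> s q p E < a"
  obtains g where "g \<in> W0" "\<rho> g < a" "AE x in N. x \<in> E \<longrightarrow> 1 \<le> g x"
proof -
  obtain U g where "E \<subseteq> U" "g \<in> W0" "\<rho> g < a" "AE x in lebesgue. x \<in> U \<inter> \<Omega> \<longrightarrow> 1 \<le> g x"
    using assms unfolding rel_capacity_def rel_capacity_open_def INF_less_iff by auto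
  moreover from this have "AE x in N. x \<in> E \<longrightarrow> 1 \<le> g x"
    unfolding AE_N_iff by (auto elim!: eventually_mono)
  ultimately show thesis using that by blast
qed

text \<open>A test function may be negative off its set and spoil a sum, so both are first replaced
  by nonnegative majorants. The result serves as subadditivity of the capacity up to a
  constant.\<close>

lemma common_test_function:
  assumes d: "0 < d"
    and cap: "rel_capacity \<Omega> s q p E < ennreal d" "rel_capacity \<Omega> s q p F < ennreal d"
  obtains g where "g \<in> W0" "\<rho> g \<le> ennreal (4 powr P * (4 * approx_const * d))" "AE x in N. x \<in> E \<union> F \<longrightarrow> 1 \<le> g x"
proof -
  have majorant: "\<exists>g\<in>W0. \<rho> g \<le> ennreal (2 * approx_const * d) \<and> (AE x in N. 0 \<le> g x) \<and> (AE x in N. x \<in> A \<longrightarrow> 1 \<le> g x)"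
    if "rel_capacity \<Omega> s q p A < ennreal d" for A
  proof -
    obtain h where h: "h \<in> W0" "\<rho> h < ennreal d" "AE x in N. x \<in> A \<longrightarrow> 1 \<le> h x"
      using rel_capacity_lessE[OF \<open>rel_capacity \<Omega> s q p A < ennreal d\<close>] .
    obtain g where g: "g \<in> W0" "\<rho> g \<le> ennreal (2 * approx_const * d)" "AE x in N. \<bar>h x\<bar> \<le> g x"
      using W0_majorant[OF h(1) d less_imp_le[OF h(2)]] .
    have "AE x in N. 0 \<le> g x"
      using g(3) by eventually_elim auto
    moreover have "AE x in N. x \<in> A \<longrightarrow> 1 \<le> g x"
      using g(3) h(3) by eventually_elim auto
    ultimately show ?thesis using g by blast
  qed
  obtain g1 where g1: "g1 \<in> W0" "\<rho> g1 \<le> ennreal (2 * approx_const * d)"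
    "AE x in N. 0 \<le> g1 x" "AE x in N. x \<in> E \<longrightarrow> 1 \<le> g1 x"
    using majorant[OF cap(1)] by blast
  obtain g2 where g2: "g2 \<in> W0" "\<rho> g2 \<le> ennreal (2 * approx_const * d)"
    "AE x in N. 0 \<le> g2 x" "AE x in N. x \<in> F \<longrightarrow> 1 \<le> g2 x"
    using majorant[OF cap(2)] by blast
  show thesis
  proof
    show "(\<lambda>x. g1 x + g2 x) \<in> W0"
      using g1 g2 by (intro W0_add)
    have "\<rho> (\<lambda>x. g1 x + g2 x) \<le> ennreal (4 powr P) * (\<rho> g1 + \<rho> g2)"
      using g1 g2 W0_subset W_measurable by (intro modular_add_le) auto
    also have "\<dots> \<le> ennreal (4 powr P) * (ennreal (2 * approx_const * d) + ennreal (2 * approx_const * d))"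
      by (intro mult_left_mono add_mono g1 g2) auto
    also have "\<dots> = ennreal (4 powr P * (4 * approx_const * d))"
      using d by (simp add: approx_const_def ennreal_mult'[symmetric] ennreal_plus[symmetric] del: ennreal_plus)
    finally show "\<rho> (\<lambda>x. g1 x + g2 x) \<le> ennreal (4 powr P * (4 * approx_const * d))" .
    show "AE x in N. x \<in> E \<union> F \<longrightarrow> 1 \<le> g1 x + g2 x"
      using g1(3,4) g2(3,4) by eventually_elim auto
  qed
qed

section \<open>Existence and uniqueness of the quasicontinuous representative\<close>

lemma quasicontinuous_representative:
  assumes u: "u \<in> W0"
  obtains w where "rel_quasicontinuous \<Omega> s q p w" "AE x in N. w x = u x"
proof -
  \<comment> \<open>The added 1 keeps \<open>\<eta>\<close> positive when the modular of
    \<open>u\<close> vanishes.\<close>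
  define \<eta> where "\<eta> = enn2real (\<rho> u) + 1"
  have "\<rho> u < \<infinity>"
    using u W0_subset by (auto simp: frac_sobolev_def)
  then have "\<rho> u = ennreal (enn2real (\<rho> u))"
    by simp
  also have "\<dots> \<le> ennreal \<eta>"
    unfolding \<eta>_def by (intro ennreal_leI) auto
  finally have \<eta>: "0 < \<eta>" "\<rho> u \<le> ennreal \<eta>"
    by (auto simp: \<eta>_def add_nonneg_pos)
  obtain v where v: "v 0 = (\<lambda>_. 0)" "\<And>k. v k \<in> Wc"
    "\<And>k. ennreal (2 powr (real (Suc k) * P)) * \<rho> (\<lambda>x. 2 ^ k * (v (Suc k) x - v k x)) \<le> ennreal (approx_const * \<eta> * (1/2) ^ k)"
    "AE x in N. (\<lambda>k. v k x) \<longlonglongrightarrow> u x"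
    using rapid_approximation[OF u \<eta>] by blast
  define f where "f k x = 2 ^ k * (v (Suc k) x - v k x)" for k x
  \<comment> \<open>One function for all \<open>e\<close>; only the exceptional set varies. The
    points of \<open>\<Omega>\<close> where this series diverges, and \<open>w\<close> has an
    arbitrary value, lie in every exceptional set constructed below.\<close>
  define w where "w x = (\<Sum>k. v (Suc k) x - v k x)" for x
  have f_Wc: "f k \<in> Wc" for k
    unfolding f_def using v(2) by (intro Wc_cmult Wc_diff)
  have cont: "continuous_on \<Omega> (v k)" "continuous_on \<Omega> (f k)" for k
    using v(2)[of k] f_Wc[of k] closure_subset[of \<Omega>]
    by (auto simp: Cc_closure_def intro: continuous_on_subset)
  have "AE x in N. w x = u x"
    using v(4)
  proof eventually_elim
    case (elim x)
    from telescope_sums[OF this] v(1) show ?case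
      by (simp add: w_def sums_iff)
  qed
  moreover have "rel_quasicontinuous \<Omega> s q p w"
    unfolding rel_quasicontinuous_def
  proof (intro allI impI)
    fix e :: real assume "0 < e"
    have "(\<lambda>m. 2 * approx_const * \<eta> * (1/2) ^ m) \<longlonglongrightarrow> 2 * approx_const * \<eta> * 0"
      by (intro tendsto_mult tendsto_const LIMSEQ_power_zero) auto
    then have "\<forall>\<^sub>F m in sequentially. 2 * approx_const * \<eta> * (1/2) ^ m < e"
      using \<open>0 < e\<close> by (intro order_tendstoD(2)) auto
    then obtain m where m: "2 * approx_const * \<eta> * (1/2) ^ m < e"
      by (auto simp: eventually_sequentially)
    \<comment> \<open>Because \<open>f n\<close> contains the factor \<open>2 ^ n\<close>, the
      threshold 1 means \<open>(1/2) ^ n\<close> for the \<open>n\<close>-th difference of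
      \<open>v\<close>. The inequality is strict to make the set open.\<close>
    define U where "U = (\<Union>k. \<Omega> \<inter> (\<lambda>x. \<bar>f (k + m) x\<bar>) -` {1<..})"
    have "open U"
      unfolding U_def using cont
      by (intro open_UN ballI continuous_open_preimage open_\<Omega> continuous_intros) auto
    have "U \<subseteq> \<Omega>" by (auto simp: U_def)
    define a where "a k = approx_const * \<eta> * (1/2) ^ (k + m)" for k
    define g where "g x = (\<Sum>k. \<bar>f (k + m) x\<bar>)" for x
    have a_le: "ennreal (2 powr (real (Suc k) * P)) * \<rho> (f (k + m)) \<le> ennreal (a k)" for k
      unfolding a_def using v(3)[of "k + m"]
      by (intro order_trans[OF weight_mono[of k _ m]]) (simp add: f_def[abs_def])
    have a: "0 \<le> a k" "a sums (2 * approx_const * \<eta> * (1/2) ^ m)" for k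
    proof -
      show "0 \<le> a k" using \<eta> by (simp add: a_def approx_const_def)
      have "(\<lambda>k. (approx_const * \<eta> * (1/2) ^ m) * (1/2) ^ k) sums ((approx_const * \<eta> * (1/2) ^ m) * (1 / (1 - 1/2)))"
        by (intro sums_mult geometric_sums) auto
      then show "a sums (2 * approx_const * \<eta> * (1/2) ^ m)"
        by (simp add: a_def[abs_def] power_add ac_simps)
    qed
    have sm: "AE x in N. summable (\<lambda>k. \<bar>f (k + m) x\<bar>)" and g: "g \<in> W0" "\<rho> g \<le> ennreal (\<Sum>k. a k)"
      using abs_series[of "\<lambda>k. f (k + m)" a] f_Wc a_le a
      unfolding g_def[abs_def] by (auto simp: sums_iff)
    have "AE x in N. x \<in> U \<longrightarrow> 1 \<le> g x"
      using sm
    proof (eventually_elim, intro impI)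
      fix x assume sx: "summable (\<lambda>k. \<bar>f (k + m) x\<bar>)" and "x \<in> U"
      then obtain k where "1 < \<bar>f (k + m) x\<bar>" by (auto simp: U_def)
      also have "\<dots> \<le> g x"
        unfolding g_def using sum_le_suminf[OF sx, of "{k}"] by auto
      finally show "1 \<le> g x" by simp
    qed
    then have "rel_capacity \<Omega> s q p U \<le> \<rho> g"
      by (intro rel_capacity_le[of U] \<open>open U\<close> \<open>U \<subseteq> \<Omega>\<close> g) auto
    also have "\<dots> \<le> ennreal (2 * approx_const * \<eta> * (1/2) ^ m)"
      using g(2) a(2) by (simp add: sums_iff)
    also have "\<dots> < ennreal e"
      using m \<open>0 < e\<close> by (rule ennreal_lessI[rotated])
    finally have "rel_capacity \<Omega> s q p U < ennreal e" .
    moreover have "continuous_on (\<Omega> - U) w"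
    proof (rule uniform_limit_theorem)
      show "uniform_limit (\<Omega> - U) (\<lambda>n x. \<Sum>k<n. v (Suc k) x - v k x) w sequentially"
        unfolding w_def
      \<comment> \<open>The bound is available only from the index \<open>m\<close> on, hence the
        eventual form of the test.\<close>
      proof (rule Weierstrass_m_test_ev)
        have "norm (v (Suc n) x - v n x) \<le> (1/2) ^ n" if "m \<le> n" "x \<in> \<Omega> - U" for n x
        proof -
          have "\<bar>f (n - m + m) x\<bar> \<le> 1"
            using that(2) unfolding U_def by (simp add: not_less)
          then have "2 ^ n * \<bar>v (Suc n) x - v n x\<bar> \<le> 1"
            using that(1) by (simp add: f_def abs_mult)
          then show ?thesis
            by (simp add: power_one_over pos_le_divide_eq mult.commute)
        qed
        then show "\<forall>\<^sub>F n in sequentially. \<forall>x\<in>\<Omega> - U. norm (v (Suc n) x - v n x) \<le> (1/2) ^ n"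
          by (auto simp: eventually_sequentially)
      qed (auto intro: summable_geometric)
      show "\<forall>\<^sub>F n in sequentially. continuous_on (\<Omega> - U) (\<lambda>x. \<Sum>k<n. v (Suc k) x - v k x)"
        by (intro always_eventually allI continuous_intros continuous_on_subset[OF cont(1)]) auto
    qed simp
    moreover have "openin (top_of_set (closure \<Omega>)) U"
      using \<open>open U\<close> \<open>U \<subseteq> \<Omega>\<close> closure_subset by (intro open_subset) auto
    ultimately show "\<exists>U. openin (top_of_set (closure \<Omega>)) U \<and> U \<subseteq> \<Omega> \<and>
        rel_capacity \<Omega> s q p U < ennreal e \<and> continuous_on (\<Omega> - U) w"
      using \<open>U \<subseteq> \<Omega>\<close> by blast
  qed
  ultimately show thesis using that by blast
qed

lemma quasicontinuous_unique:
  assumes qc: "rel_quasicontinuous \<Omega> s q p w1" "rel_quasicontinuous \<Omega> s q p w2"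
    and eq: "AE x in N. w1 x = w2 x"
  shows "rel_polar \<Omega> s q p {x \<in> \<Omega>. w1 x \<noteq> w2 x}" (is "rel_polar _ _ _ _ ?D")
  unfolding rel_polar_def
proof
  have le: "rel_capacity \<Omega> s q p ?D \<le> 0 + ennreal e" if "0 < e" for e
  proof -
    \<comment> \<open>Compensates exactly for the constant in
      \<open>common_test_function\<close>.\<close>
    define d where "d = e / (4 powr P * (4 * approx_const))"
    have d: "0 < d" "4 powr P * (4 * approx_const * d) = e"
      using \<open>0 < e\<close> by (auto simp: d_def approx_const_def)
    obtain U1 where U1: "openin (top_of_set (closure \<Omega>)) U1" "U1 \<subseteq> \<Omega>"
      "rel_capacity \<Omega> s q p U1 < ennreal d" "continuous_on (\<Omega> - U1) w1"
      using qc(1) d(1) unfolding rel_quasicontinuous_def by blast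
    obtain U2 where U2: "openin (top_of_set (closure \<Omega>)) U2" "U2 \<subseteq> \<Omega>"
      "rel_capacity \<Omega> s q p U2 < ennreal d" "continuous_on (\<Omega> - U2) w2"
      using qc(2) d(1) unfolding rel_quasicontinuous_def by blast
    obtain g where g: "g \<in> W0" "\<rho> g \<le> ennreal e" "AE x in N. x \<in> U1 \<union> U2 \<longrightarrow> 1 \<le> g x"
      using common_test_function[OF d(1) U1(3) U2(3)] unfolding d(2) .
    have open_rel: "open U" if "openin (top_of_set (closure \<Omega>)) U" "U \<subseteq> \<Omega>" for U
    proof -
      have "openin (top_of_set \<Omega>) U"
        using that closure_subset by (rule openin_subset_trans)
      then show ?thesis using open_\<Omega> by (rule openin_open_trans)
    qed
    define S where "S = \<Omega> - (U1 \<union> U2)"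
    have "continuous_on S (\<lambda>x. w1 x - w2 x)"
      using U1(4) U2(4) by (intro continuous_on_diff) (auto simp: S_def intro: continuous_on_subset)
    then have "openin (top_of_set S) (S \<inter> (\<lambda>x. w1 x - w2 x) -` (- {0}))"
      by (rule continuous_openin_preimage_gen) auto
    \<comment> \<open>\<open>S\<close> need not be open, so the disagreement set in \<open>S\<close>
      is merely the trace of an open \<open>G\<close>. Adding \<open>U1\<close> and
      \<open>U2\<close> to \<open>\<Omega> \<inter> G\<close> restores openness.\<close>
    then obtain G where G: "open G" "S \<inter> (\<lambda>x. w1 x - w2 x) -` (- {0}) = S \<inter> G"
      by (auto simp: openin_open)
    then have G_iff: "w1 x \<noteq> w2 x \<longleftrightarrow> x \<in> G" if "x \<in> \<Omega>" "x \<notin> U1" "x \<notin> U2" for x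
      using that by (auto simp: S_def set_eq_iff)
    define V where "V = (\<Omega> \<inter> G) \<union> U1 \<union> U2"
    have "open V"
      unfolding V_def using G(1) open_\<Omega> open_rel[OF U1(1,2)] open_rel[OF U2(1,2)]
      by (intro open_Un open_Int)
    have "V \<subseteq> \<Omega>"
      using U1(2) U2(2) by (auto simp: V_def)
    have "?D \<subseteq> V"
      using G_iff by (auto simp: V_def)
    have V: "w1 x \<noteq> w2 x \<or> x \<in> U1 \<union> U2" if "x \<in> V" for x
      using G_iff that by (auto simp: V_def)
    \<comment> \<open>On \<open>V\<close> outside \<open>U1 \<union> U2\<close> the functions
      differ, which by \<open>eq\<close> happens only on a null set.\<close>
    have "AE x in N. x \<in> V \<longrightarrow> 1 \<le> g x"
      using g(3) eq by eventually_elim (use V in blast)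
    with \<open>open V\<close> \<open>V \<subseteq> \<Omega>\<close> \<open>?D \<subseteq> V\<close> g(1) have "rel_capacity \<Omega> s q p ?D \<le> \<rho> g"
      by (rule rel_capacity_le)
    then show ?thesis using g(2) by simp
  qed
  have "rel_capacity \<Omega> s q p ?D \<le> 0"
    by (rule ennreal_le_epsilon) (rule le)
  then show "rel_capacity \<Omega> s q p ?D = 0" by simp
qed auto

end

section \<open>Borel version of the exponent and choice of a common bound\<close>

text \<open>Fubini gives null sections with the first coordinate outside, whereas the Gagliardo
  modular integrates over \<open>x\<close> inside. Exchanging the quantifiers uses that
  \<open>B\<close> is measurable.\<close>

lemma AE_AE_swap_of_null_set:
  assumes "B \<in> null_sets (lborel :: ('a::euclidean_space \<times> 'a) measure)"
  shows "AE y in lborel. AE x in lborel. (x, y) \<notin> B"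
proof -
  have B: "B \<in> null_sets (lborel \<Otimes>\<^sub>M lborel)"
    using assms by (simp add: lborel_prod)
  then have "AE z in lborel \<Otimes>\<^sub>M lborel. z \<notin> B"
    by (rule AE_not_in)
  then have "AE x in lborel. AE y in lborel. (x, y) \<notin> B"
    by (rule lborel_pair.AE_pair)
  moreover have "{z \<in> space (lborel \<Otimes>\<^sub>M lborel). (fst z, snd z) \<notin> B} = space (lborel \<Otimes>\<^sub>M lborel) - B"
    by auto
  then have "{z \<in> space (lborel \<Otimes>\<^sub>M lborel). (fst z, snd z) \<notin> B} \<in> sets (lborel \<Otimes>\<^sub>M lborel)"
    using null_setsD2[OF B] sets.compl_sets by metis
  ultimately show ?thesis
    using lborel_pair.AE_commute[of "\<lambda>x y. (x, y) \<notin> B"] by blast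
qed

lemma exponent_sup_bound:
  assumes "exponent_sup A r < \<infinity>"
  shows "\<exists>c. AE z in lebesgue_on A. r z \<le> c"
proof -
  have *: "AE z in lebesgue_on A. ereal (r z) \<le> exponent_sup A r"
    unfolding exponent_sup_def by (rule esssup_AE)
  show ?thesis
  proof (cases "exponent_sup A r")
    case (real c)
    then show ?thesis using * by auto
  next
    \<comment> \<open>This occurs for the empty set, for example.\<close>
    case MInf
    then have "AE z in lebesgue_on A. r z \<le> 0"
      using * by auto
    then show ?thesis by blast
  qed (use assms in auto)
qed

text \<open>A Lebesgue measurable function has a Borel version. Clamping it to \<open>[1, P]\<close>
  makes the bounds hold everywhere and changes nothing where it equals \<open>p\<close> with
  \<open>p\<close> within the bounds. A Borel null set covers the remaining points, and almost all
  of its sections are null.\<close>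

lemma borel_exponent:
  fixes \<Omega> :: "'a::euclidean_space set" and p :: "'a \<times> 'a \<Rightarrow> real"
  assumes "open \<Omega>" "p \<in> borel_measurable (lebesgue_on (\<Omega> \<times> \<Omega>))" "1 \<le> P"
    and p: "AE z in lebesgue_on (\<Omega> \<times> \<Omega>). 1 \<le> p z \<and> p z \<le> P"
  obtains p' where "p' \<in> borel_measurable borel" "\<And>z. 1 \<le> p' z \<and> p' z \<le> P"
    "AE y in lebesgue_on \<Omega>. AE x in lebesgue_on \<Omega>. p (x, y) = p' (x, y)"
proof -
  have \<Omega>2: "\<Omega> \<times> \<Omega> \<in> sets lebesgue" and \<Omega>: "\<Omega> \<in> sets lebesgue"
    using assms(1) by (auto simp: open_Times)
  define p0 where "p0 z = (if z \<in> \<Omega> \<times> \<Omega> then p z else 0)" for z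
  have "p0 \<in> borel_measurable lebesgue"
    unfolding p0_def using assms(2) \<Omega>2 by (subst borel_measurable_if) auto
  then obtain h where h: "h \<in> borel_measurable lborel" "AE z in lborel. p0 z = h z"
    using completion_ex_borel_measurable_real by blast
  define p' where "p' z = max 1 (min P (h z))" for z
  have "AE z in lebesgue. z \<in> \<Omega> \<times> \<Omega> \<longrightarrow> 1 \<le> p z \<and> p z \<le> P"
    using p \<Omega>2 by (subst (asm) AE_restrict_space_iff) auto
  then have "AE z in lborel. z \<in> \<Omega> \<times> \<Omega> \<longrightarrow> p z = p' z"
    using h(2) unfolding AE_completion_iff
    by eventually_elim (auto simp: p0_def p'_def)
  then obtain B where B: "B \<in> null_sets lborel" "{z. \<not> (z \<in> \<Omega> \<times> \<Omega> \<longrightarrow> p z = p' z)} \<subseteq> B"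
    by (auto simp: eventually_ae_filter)
  have "AE y in lebesgue. AE x in lebesgue. (x, y) \<notin> B"
    unfolding AE_completion_iff by (rule AE_AE_swap_of_null_set[OF B(1)])
  then have "AE y in lebesgue. y \<in> \<Omega> \<longrightarrow> (AE x in lebesgue. x \<in> \<Omega> \<longrightarrow> p (x, y) = p' (x, y))"
  proof (eventually_elim, intro impI)
    fix y assume "AE x in lebesgue. (x, y) \<notin> B" "y \<in> \<Omega>"
    then show "AE x in lebesgue. x \<in> \<Omega> \<longrightarrow> p (x, y) = p' (x, y)"
      using B(2) by (auto elim!: eventually_mono)
  qed
  then have "AE y in lebesgue_on \<Omega>. AE x in lebesgue_on \<Omega>. p (x, y) = p' (x, y)"
    using \<Omega> by (simp add: AE_restrict_space_iff)
  moreover have "p' \<in> borel_measurable borel"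
    unfolding p'_def using h(1) by measurable
  moreover have "1 \<le> p' z \<and> p' z \<le> P" for z
    using assms(3) by (auto simp: p'_def)
  ultimately show thesis using that by blast
qed

lemma frac_space_exists:
  fixes \<Omega> :: "'a::euclidean_space set"
  assumes "open \<Omega>" and q: "q \<in> exponents \<Omega>" and p: "p \<in> exponents (\<Omega> \<times> \<Omega>)"
    and "exponent_sup \<Omega> q < \<infinity>" "exponent_sup (\<Omega> \<times> \<Omega>) p < \<infinity>"
  obtains P p' where "frac_space \<Omega> q p P p'"
proof -
  obtain a b where ab: "AE x in lebesgue_on \<Omega>. q x \<le> a" "AE z in lebesgue_on (\<Omega> \<times> \<Omega>). p z \<le> b"
    using exponent_sup_bound[OF assms(4)] exponent_sup_bound[OF assms(5)] by blast
  \<comment> \<open>The 1 keeps \<open>[1, P]\<close> nonempty even if \<open>a\<close> and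
    \<open>b\<close> carry no information, as for empty \<open>\<Omega>\<close>.\<close>
  define P where "P = max 1 (max a b)"
  have q_AE: "AE x in lebesgue_on \<Omega>. 1 \<le> q x \<and> q x \<le> P"
    using ab(1) AE_space by eventually_elim (use q in \<open>auto simp: exponents_def P_def\<close>)
  have p_AE: "AE z in lebesgue_on (\<Omega> \<times> \<Omega>). 1 \<le> p z \<and> p z \<le> P"
    using ab(2) AE_space by eventually_elim (use p in \<open>auto simp: exponents_def P_def\<close>)
  have meas: "q \<in> borel_measurable (lebesgue_on \<Omega>)" "p \<in> borel_measurable (lebesgue_on (\<Omega> \<times> \<Omega>))"
    using p q by (simp_all add: exponents_def)
  have "1 \<le> P" by (simp add: P_def)
  then obtain p' where "p' \<in> borel_measurable borel" "\<And>z. 1 \<le> p' z \<and> p' z \<le> P"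
    "AE y in lebesgue_on \<Omega>. AE x in lebesgue_on \<Omega>. p (x, y) = p' (x, y)"
    using borel_exponent[OF assms(1) meas(2) _ p_AE] by blast
  with assms(1) meas(1) q_AE have "frac_space \<Omega> q p P p'"
    by (rule frac_space.intro)
  then show thesis by (rule that)
qed

theorem theorem2p6:
  fixes \<Omega> :: "(real ^ 'n) set"
    and s :: real
    and q :: "real ^ 'n \<Rightarrow> real"
    and p :: "(real ^ 'n) \<times> (real ^ 'n) \<Rightarrow> real"
    and u :: "real ^ 'n \<Rightarrow> real"
  assumes "open \<Omega>"
    and "0 < s" and "s < 1"
    and "q \<in> exponents \<Omega>"
    and "p \<in> exponents (\<Omega> \<times> \<Omega>)"
    and "1 < exponent_inf \<Omega> q"
    and "exponent_inf \<Omega> q \<le> exponent_sup \<Omega> q"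
    and "exponent_sup \<Omega> q < \<infinity>"
    and "1 < exponent_inf (\<Omega> \<times> \<Omega>) p"
    and "exponent_inf (\<Omega> \<times> \<Omega>) p \<le> exponent_sup (\<Omega> \<times> \<Omega>) p"
    and "exponent_sup (\<Omega> \<times> \<Omega>) p < \<infinity>"
    and "u \<in> frac_sobolev_tilde \<Omega> s q p"
  shows "(\<exists>w. rel_quasicontinuous \<Omega> s q p w \<and> (AE x in lebesgue_on \<Omega>. w x = u x)) \<and>
    (\<forall>w1 w2. rel_quasicontinuous \<Omega> s q p w1 \<and> (AE x in lebesgue_on \<Omega>. w1 x = u x) \<and>
             rel_quasicontinuous \<Omega> s q p w2 \<and> (AE x in lebesgue_on \<Omega>. w2 x = u x) \<longrightarrow>
       (\<exists>P. rel_polar \<Omega> s q p P \<and> (\<forall>x\<in>\<Omega> - P. w1 x = w2 x)))"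
proof -
  obtain P p' where "frac_space \<Omega> q p P p'"
    using frac_space_exists[of \<Omega> q p] assms by blast
  then interpret frac_space \<Omega> s q p P p' .
  show ?thesis
  proof (intro conjI allI impI)
    show "\<exists>w. rel_quasicontinuous \<Omega> s q p w \<and> (AE x in lebesgue_on \<Omega>. w x = u x)"
      using quasicontinuous_representative assms(12) by blast
    fix w1 w2
    assume w: "rel_quasicontinuous \<Omega> s q p w1 \<and> (AE x in lebesgue_on \<Omega>. w1 x = u x) \<and>
      rel_quasicontinuous \<Omega> s q p w2 \<and> (AE x in lebesgue_on \<Omega>. w2 x = u x)"
    then have "AE x in lebesgue_on \<Omega>. w1 x = u x" "AE x in lebesgue_on \<Omega>. w2 x = u x"
      by auto
    then have "AE x in lebesgue_on \<Omega>. w1 x = w2 x"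
      by eventually_elim simp
    then have "rel_polar \<Omega> s q p {x \<in> \<Omega>. w1 x \<noteq> w2 x}"
      using w by (intro quasicontinuous_unique) auto
    then show "\<exists>P. rel_polar \<Omega> s q p P \<and> (\<forall>x\<in>\<Omega> - P. w1 x = w2 x)"
      by (intro exI[of _ "{x \<in> \<Omega>. w1 x \<noteq> w2 x}"]) auto
  qed
qed

end
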